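(* Let $(\mu_n)_{n}$ be a sequence in $\mathcal P(\mathbb T)$ such that $\mu_n$ is a non-uniform stationary solution of the Kuramoto mean field game with interaction parameter $\kappa_n$, where $\kappa_n\to\infty$ (with $\beta,\sigma$ fixed). Then there exists a sequence $z_n\in\mathbb T$ such that the translated stationary solutions $\mu_n(\cdot\,;z_n)$ converge in law to the Dirac measure $\delta_{\{0\}}$.
   Context: Fixed constants $\beta>0$ (discount), $\sigma>0$ (noise); interaction parameters $\kappa>0$. State space: the torus $\mathbb T=\mathbb R/(2\pi\mathbb Z)$; $\mathcal P(\mathbb T)$ is the set of Borel probability measures on $\mathbb T$; $\nu(f)=\int_{\mathbb T} f\,d\nu$; $U(dx)=dx/(2\pi)$ is the uniform measure. A filtered probability space satisfying the usual conditions is fixed, carrying a Brownian motion $B$ adapted to the filtration, with $\mathcal F_0$ rich enough that every $\mu_0\in\mathcal P(\mathbb T)$ is the law of some $\mathcal F_0$-measurable $\mathbb T$-valued $X_0$. $\mathcal A$ is the set of real-valued progressively measurable processes $\alpha=(\alpha_t)_{t\ge0}$. Given a flow $\boldsymbol\mu=(\mu_t)_{t\ge0}$ in $\mathcal P(\mathbb T)$, set $\ell_{\boldsymbol\mu}(t,x)=-\kappa\mu_t(\cos)\cos(x)-\kappa\mu_t(\sin)\sin(x)$ and $$J_{\boldsymbol\mu,\kappa}(\alpha)=\mathbb E\int_0^\infty e^{-\beta t}\Big(\ell_{\boldsymbol\mu}(t,X^\alpha_t)+\tfrac12\alpha_t^2\Big)dt,\qquad X^\alpha_t=X_0+\int_0^t\alpha_u\,du+\sigma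 B_t,$$ where $X_0$ has law $\mu_0$. The flow $\boldsymbol\mu$ is a solution of the Kuramoto mean field game with interaction parameter $\kappa$ starting from $\mu_0$ if there is $\alpha^*\in\mathcal A$ with $J_{\boldsymbol\mu,\kappa}(\alpha^* )=\inf_{\alpha\in\mathcal A}J_{\boldsymbol\mu,\kappa}(\alpha)$ and $\mu_t$ is the law of $X^{\alpha^*}_t$ on $\mathbb T$ for all $t\ge0$. $\mu\in\mathcal P(\mathbb T)$ is a stationary solution if the constant flow $\mu_t=\mu$, $t\ge0$, is a solution; it is non-uniform if $\mu\ne U$. Translation: for $\mu\in\mathcal P(\mathbb T)$, $x\in\mathbb T$ and Borel $B\subset\mathbb T$, $\mu(B;x):=\mu(\{z\in\mathbb T: x+z\in B\})$. *)

theory Defs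
  imports "HOL-Probability.Probability"
begin

section \<open>The torus\<close>

quotient_type torus = real / "\<lambda>x y. \<exists>k::int. x - y = 2 * pi * of_int k"
  morphisms rep_torus to_torus
proof (rule equivpI)
  show "reflp (\<lambda>x y. \<exists>k::int. x - y = 2 * pi * of_int k)"
    by (rule reflpI, rule exI[of _ 0]) simp
  show "symp (\<lambda>x y. \<exists>k::int. x - y = 2 * pi * of_int k)"
  proof (rule sympI, elim exE)
    fix x y :: real and k :: int
    assume "x - y = 2 * pi * of_int k"
    then show "\<exists>k::int. y - x = 2 * pi * of_int k"
      by (intro exI[of _ "- k"]) simp
  qed
  show "transp (\<lambda>x y. \<exists>k::int. x - y = 2 * pi * of_int k)"
  proof (rule transpI, elim exE)
    fix x y z :: real and k l :: int
    assume "x - y = 2 * pi * of_int k" "y - z = 2 * pi * of_int l"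
    then show "\<exists>k::int. x - z = 2 * pi * of_int k"
      by (intro exI[of _ "k + l"]) (simp add: algebra_simps)
  qed
qed

instantiation torus :: ab_group_add
begin

lift_definition zero_torus :: torus is "0 :: real" .

lift_definition plus_torus :: "torus \<Rightarrow> torus \<Rightarrow> torus" is "(+) :: real \<Rightarrow> real \<Rightarrow> real"
proof (elim exE)
  fix a b c d :: real and k l :: int
  assume "a - b = 2 * pi * of_int k" "c - d = 2 * pi * of_int l"
  then show "\<exists>k::int. (a + c) - (b + d) = 2 * pi * of_int k"
    by (intro exI[of _ "k + l"]) (simp add: algebra_simps)
qed

lift_definition uminus_torus :: "torus \<Rightarrow> torus" is "uminus :: real \<Rightarrow> real"
proof (elim exE)
  fix a b :: real and k :: int
  assume "a - b = 2 * pi * of_int k"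
  then show "\<exists>k::int. (- a) - (- b) = 2 * pi * of_int k"
    by (intro exI[of _ "- k"]) simp
qed

definition minus_torus :: "torus \<Rightarrow> torus \<Rightarrow> torus" where
  "minus_torus x y = x + (- y)"

instance
proof
  show "a + b + c = a + (b + c)" for a b c :: torus
    by transfer (rule exI[of _ 0], simp)
  show "a + b = b + a" for a b :: torus
    by transfer (rule exI[of _ 0], simp)
  show "0 + a = a" for a :: torus
    by transfer (rule exI[of _ 0], simp)
  show "- a + a = 0" for a :: torus
    by transfer (rule exI[of _ 0], simp)
qed (simp add: minus_torus_def)

end

text \<open>The quotient topology.\<close>

instantiation torus :: topological_space
begin

definition open_torus :: "torus set \<Rightarrow> bool" where
  "open_torus S \<longleftrightarrow> open (to_torus -` S)"

instance
proof
  show "open (UNIV :: torus set)"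
    by (simp add: open_torus_def)
  show "open (S \<inter> T)" if "open S" "open T" for S T :: "torus set"
    using that by (simp add: open_torus_def open_Int)
  show "open (\<Union>K)" if "\<forall>S\<in>K. open S" for K :: "torus set set"
    using that by (simp add: open_torus_def vimage_Union open_UN)
qed

end

lift_definition cos_torus :: "torus \<Rightarrow> real" is cos
proof (elim exE)
  fix x y :: real and k :: int
  assume "x - y = 2 * pi * of_int k"
  then have "x = y + 2 * pi * of_int k" by simp
  then show "cos x = cos y" by (simp add: cos_add)
qed

lift_definition sin_torus :: "torus \<Rightarrow> real" is sin
proof (elim exE)
  fix x y :: real and k :: int
  assume "x - y = 2 * pi * of_int k"
  then have "x = y + 2 * pi * of_int k" by simp
  then show "sin x = sin y" by (simp add: sin_add)
qed


section \<open>Probability measures on the torus\<close>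

definition torus_prob :: "torus measure set" where
  "torus_prob = {\<mu>. prob_space \<mu> \<and> sets \<mu> = sets borel}"

definition uniform_torus :: "torus measure" where
  "uniform_torus = distr (uniform_measure lborel {0..<2 * pi}) borel to_torus"

definition translate :: "torus measure \<Rightarrow> torus \<Rightarrow> torus measure" where
  "translate \<mu> x = distr \<mu> borel (\<lambda>z. x + z)"

lemma continuous_on_torus_add: "continuous_on UNIV (\<lambda>z::torus. x + z)"
proof -
  obtain r where r: "x = to_torus r"
    using Quotient3_abs_rep[OF Quotient3_torus, of x] by (rule that[OF sym])
  have add: "to_torus r + to_torus y = to_torus (r + y)" for y
    by (simp add: plus_torus.abs_eq)
  have "open ((\<lambda>z. x + z) -` S)" if "open S" for S
  proof -
    have "to_torus -` ((\<lambda>z. x + z) -` S) = (\<lambda>y. r + y) -` (to_torus -` S)"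
      by (auto simp: r add)
    moreover have "open ((\<lambda>y. r + y) -` (to_torus -` S))"
      using that by (intro open_vimage[OF _ continuous_on_add]) (simp_all add: open_torus_def)
    ultimately show ?thesis
      by (simp add: open_torus_def)
  qed
  then show ?thesis
    by (simp add: continuous_on_open_vimage)
qed

lemma emeasure_translate:
  assumes "\<mu> \<in> torus_prob" "A \<in> sets borel"
  shows "emeasure (translate \<mu> x) A = emeasure \<mu> {z. x + z \<in> A}"
proof -
  have s: "sets \<mu> = sets borel" using assms by (simp add: torus_prob_def)
  then have sp: "space \<mu> = UNIV" using sets_eq_imp_space_eq[OF s] by simp
  have "(\<lambda>z. x + z) \<in> measurable \<mu> borel"
    using borel_measurable_continuous_onI[OF continuous_on_torus_add, of x]
    by (simp add: measurable_cong_sets[OF s refl])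
  then show ?thesis
    using assms by (simp add: translate_def emeasure_distr sp vimage_def)
qed

definition converges_in_law ::
  "(nat \<Rightarrow> 'a::topological_space measure) \<Rightarrow> 'a measure \<Rightarrow> bool" where
  "converges_in_law \<mu> \<nu> \<longleftrightarrow>
     (\<forall>f :: 'a \<Rightarrow> real. continuous_on UNIV f \<and> bounded (range f) \<longrightarrow>
        (\<lambda>n. \<integral>x. f x \<partial>\<mu> n) \<longlonglongrightarrow> (\<integral>x. f x \<partial>\<nu>))"


section \<open>The filtered probability space\<close>

text \<open>Processes and filtrations are indexed by \<^typ>\<open>real\<close>; only times \<open>t \<ge> 0\<close> are ever
  constrained or used.\<close>

definition filtered_prob_space :: "'w measure \<Rightarrow> (real \<Rightarrow> 'w measure) \<Rightarrow> bool" where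
  "filtered_prob_space M F \<longleftrightarrow> prob_space M \<and>
     (\<forall>t\<ge>0. subalgebra M (F t)) \<and>
     (\<forall>s\<ge>0. \<forall>t\<ge>s. sets (F s) \<subseteq> sets (F t))"

definition usual_conditions :: "'w measure \<Rightarrow> (real \<Rightarrow> 'w measure) \<Rightarrow> bool" where
  "usual_conditions M F \<longleftrightarrow> complete_measure M \<and>
     null_sets M \<subseteq> sets (F 0) \<and>
     (\<forall>t\<ge>0. (\<Inter>s\<in>{t<..}. sets (F s)) = sets (F t))"

text \<open>A Brownian motion relative to the filtration: adapted, with increments after time \<open>s\<close>
  independent of \<open>F s\<close>.\<close>

definition brownian_motion ::
  "'w measure \<Rightarrow> (real \<Rightarrow> 'w measure) \<Rightarrow> (real \<Rightarrow> 'w \<Rightarrow> real) \<Rightarrow> bool" where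
  "brownian_motion M F B \<longleftrightarrow>
     (\<forall>t\<ge>0. B t \<in> borel_measurable (F t)) \<and>
     (AE \<omega> in M. B 0 \<omega> = 0) \<and>
     (\<forall>\<omega>\<in>space M. continuous_on {0..} (\<lambda>t. B t \<omega>)) \<and>
     (\<forall>s\<ge>0. \<forall>t>s.
        distributed M lborel (\<lambda>\<omega>. B t \<omega> - B s \<omega>) (normal_density 0 (sqrt (t - s))) \<and>
        prob_space.indep_set M (sets (F s))
          (sets (vimage_algebra (space M) (\<lambda>\<omega>. B t \<omega> - B s \<omega>) borel)))"

definition initial_state ::
  "'w measure \<Rightarrow> (real \<Rightarrow> 'w measure) \<Rightarrow> torus measure \<Rightarrow> ('w \<Rightarrow> torus) \<Rightarrow> bool" where
  "initial_state M F \<mu> X \<longleftrightarrow> X \<in> measurable (F 0) borel \<and> distr M borel X = \<mu>"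

definition rich_initial :: "'w measure \<Rightarrow> (real \<Rightarrow> 'w measure) \<Rightarrow> bool" where
  "rich_initial M F \<longleftrightarrow> (\<forall>\<mu>\<in>torus_prob. \<exists>X. initial_state M F \<mu> X)"

definition progressively_measurable ::
  "(real \<Rightarrow> 'w measure) \<Rightarrow> (real \<Rightarrow> 'w \<Rightarrow> real) \<Rightarrow> bool" where
  "progressively_measurable F \<alpha> \<longleftrightarrow>
     (\<forall>T\<ge>0. (\<lambda>(t, \<omega>). \<alpha> t \<omega>)
        \<in> borel_measurable (restrict_space borel {0..T} \<Otimes>\<^sub>M F T))"


section \<open>The Kuramoto mean field game\<close>

text \<open>If \<open>\<alpha>\<close> is not Lebesgue integrable on \<open>[0, t]\<close>, the drift integral below is \<open>0\<close> by the
  convention for the Bochner integral. Such paths have infinite running energy, so a control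
  having them with positive probability has infinite cost whatever the convention.\<close>

definition state ::
  "real \<Rightarrow> (real \<Rightarrow> 'w \<Rightarrow> real) \<Rightarrow> ('w \<Rightarrow> torus) \<Rightarrow> (real \<Rightarrow> 'w \<Rightarrow> real) \<Rightarrow> real \<Rightarrow> 'w \<Rightarrow> torus"
where
  "state \<sigma> B X0 \<alpha> t \<omega> = X0 \<omega> + to_torus ((LBINT u:{0..t}. \<alpha> u \<omega>) + \<sigma> * B t \<omega>)"

definition running_cost :: "real \<Rightarrow> (real \<Rightarrow> torus measure) \<Rightarrow> real \<Rightarrow> torus \<Rightarrow> real" where
  "running_cost \<kappa> \<mu> t x =
     - \<kappa> * (\<integral>y. cos_torus y \<partial>\<mu> t) * cos_torus x - \<kappa> * (\<integral>y. sin_torus y \<partial>\<mu> t) * sin_torus x"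

text \<open>The integral with values in the extended reals, as the integral of the positive part minus
  the integral of the negative part (\<^const>\<open>e2ennreal\<close> maps negative numbers to \<open>0\<close>). In
  \<open>cost\<close> the negative part always has a finite integral, since \<open>running_cost\<close> is bounded below
  and \<open>\<beta> > 0\<close>; the cost may be \<open>\<infinity>\<close>.\<close>

definition ereal_integral :: "'a measure \<Rightarrow> ('a \<Rightarrow> ereal) \<Rightarrow> ereal" where
  "ereal_integral M f =
     enn2ereal (\<integral>\<^sup>+x. e2ennreal (f x) \<partial>M) - enn2ereal (\<integral>\<^sup>+x. e2ennreal (- f x) \<partial>M)"

definition cost ::
  "real \<Rightarrow> real \<Rightarrow> 'w measure \<Rightarrow> (real \<Rightarrow> 'w \<Rightarrow> real) \<Rightarrow> real \<Rightarrow> (real \<Rightarrow> torus measure)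
     \<Rightarrow> ('w \<Rightarrow> torus) \<Rightarrow> (real \<Rightarrow> 'w \<Rightarrow> real) \<Rightarrow> ereal"
where
  "cost \<beta> \<sigma> M B \<kappa> \<mu> X0 \<alpha> =
     ereal_integral M (\<lambda>\<omega>. ereal_integral (restrict_space lborel {0..}) (\<lambda>t.
       ereal (exp (- \<beta> * t) *
         (running_cost \<kappa> \<mu> t (state \<sigma> B X0 \<alpha> t \<omega>) + (\<alpha> t \<omega>)\<^sup>2 / 2))))"

definition mfg_solution ::
  "real \<Rightarrow> real \<Rightarrow> 'w measure \<Rightarrow> (real \<Rightarrow> 'w measure) \<Rightarrow> (real \<Rightarrow> 'w \<Rightarrow> real) \<Rightarrow> real
     \<Rightarrow> (real \<Rightarrow> torus measure) \<Rightarrow> bool"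
where
  "mfg_solution \<beta> \<sigma> M F B \<kappa> \<mu> \<longleftrightarrow>
     (\<forall>t\<ge>0. \<mu> t \<in> torus_prob) \<and>
     (\<exists>X0. initial_state M F (\<mu> 0) X0 \<and>
       (\<exists>\<alpha>. progressively_measurable F \<alpha> \<and>
          cost \<beta> \<sigma> M B \<kappa> \<mu> X0 \<alpha> = (INF a\<in>{a. progressively_measurable F a}. cost \<beta> \<sigma> M B \<kappa> \<mu> X0 a) \<and>
          (\<forall>t\<ge>0. distr M borel (state \<sigma> B X0 \<alpha> t) = \<mu> t)))"

definition stationary_solution ::
  "real \<Rightarrow> real \<Rightarrow> 'w measure \<Rightarrow> (real \<Rightarrow> 'w measure) \<Rightarrow> (real \<Rightarrow> 'w \<Rightarrow> real) \<Rightarrow> real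
     \<Rightarrow> torus measure \<Rightarrow> bool"
where
  "stationary_solution \<beta> \<sigma> M F B \<kappa> \<mu> \<longleftrightarrow> mfg_solution \<beta> \<sigma> M F B \<kappa> (\<lambda>_. \<mu>)"

end

theory Submission
  imports Defs
begin

text \<open>
  For a stationary solution \<open>\<mu>\<close>, write \<open>(\<integral>cos d\<mu>, \<integral>sin d\<mu>) = r (cos \<phi>, sin \<phi>)\<close> with \<open>0 \<le> r \<le> 1\<close>.
  The running cost is then \<open>- \<theta> cos (x - \<phi>)\<close> with the effective coupling \<open>\<theta> = \<kappa> r\<close>, and after
  translation by \<open>- \<phi>\<close> the measure has first cosine moment \<open>r\<close>. A sequence of laws whose cosine
  moments tend to \<open>1\<close> converges to the Dirac mass at \<open>0\<close>, so everything reduces to \<open>r \<longlongrightarrow> 1\<close>.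

  The argument uses no Hamilton-Jacobi-Bellman equation, only comparisons of costs. Along the
  optimal process the law is \<open>\<mu>\<close> at every time, so dropping the term \<open>\<alpha>\<^sup>2 / 2\<close> bounds the optimal cost
  from below by \<open>- \<theta> r / \<beta>\<close> (\<open>cost_ge_of_stationary\<close>). Every explicit control bounds it from
  above, and each of the following three controls yields one fact.

  \<^item> The zero control, when \<open>r = 0\<close>: its cost is \<open>0\<close>, so the optimal control vanishes almost everywhere
    and \<open>\<mu>\<close> is invariant under the noise \<open>\<sigma> B\<^sub>t\<close> for all \<open>t\<close>. Since a very wide Gaussian hardly
    notices a shift, \<open>\<mu>\<close> is uniform (\<open>uniform_if_order_parameter_zero\<close>). Non-uniform solutions thus
    have \<open>r > 0\<close>.
  \<^item> A small push towards \<open>\<phi>\<close>, computed from the position at time \<open>1\<close> and applied during \<open>[1, 2)\<close>: with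
    amplitude \<open>\<eta>\<close> it gains an amount of order \<open>\<theta> \<eta>\<close> and costs an amount of order \<open>\<eta>\<^sup>2 (1 + \<theta>)\<close>.
    Optimising over \<open>\<eta>\<close> gives \<open>r \<ge> c \<theta> / (1 + \<theta>)\<close>, which for \<open>r > 0\<close> says \<open>1 + \<theta> \<ge> c \<kappa>\<close>
    (\<open>effective_coupling_lower_bound\<close>); hence \<open>\<theta> \<longlongrightarrow> \<infinity>\<close>. This excludes the solutions with \<open>r\<close> of order
    \<open>1 / \<kappa>\<close>.
  \<^item> A control that on every interval of length \<open>h\<close> steers linearly to \<open>\<phi>\<close> the displacement found at its
    beginning: its cost is \<open>- \<theta> / \<beta> + O(\<theta> h + 1 / h)\<close>. With \<open>h = 1 / sqrt \<theta>\<close> this gives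
    \<open>1 - r = O(1 / sqrt \<theta>)\<close> (\<open>order_parameter_lower_bound\<close>).

  Both nontrivial controls are bounded, piecewise constant in time, and on each interval explicit
  functions of the initial state and of at most two values of the Brownian motion. Their costs
  therefore follow from independence of increments, Gaussian moments and Fubini; no stochastic
  calculus is involved.
\<close>

section \<open>The torus and its first Fourier coefficient\<close>

lemma continuous_on_to_torus: "continuous_on UNIV to_torus"
  by (simp add: continuous_on_open_vimage open_torus_def)

lemma measurable_to_torus [measurable]: "to_torus \<in> borel \<rightarrow>\<^sub>M borel"
  by (rule borel_measurable_continuous_onI[OF continuous_on_to_torus])

lemma torus_cases: obtains y where "x = to_torus y"
  using Quotient3_abs_rep[OF Quotient3_torus, of x] by metis

lemma to_torus_add: "to_torus (x + y) = to_torus x + to_torus y"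
  by (simp add: plus_torus.abs_eq)

lemma to_torus_eq_iff: "to_torus x = to_torus y \<longleftrightarrow> (\<exists>k::int. x - y = 2 * pi * of_int k)"
  using torus.abs_eq_iff by blast

lemma to_torus_eq_iff_sin_cos: "to_torus x = to_torus y \<longleftrightarrow> sin x = sin y \<and> cos x = cos y"
  unfolding to_torus_eq_iff sin_cos_eq_iff by (auto simp: algebra_simps)

lemma cos_torus_to_torus [simp]: "cos_torus (to_torus x) = cos x"
  by (simp add: cos_torus.abs_eq)

lemma sin_torus_to_torus [simp]: "sin_torus (to_torus x) = sin x"
  by (simp add: sin_torus.abs_eq)

lemma measurable_cos_torus [measurable]: "cos_torus \<in> borel_measurable borel"
proof (rule borel_measurable_continuous_onI)
  have "open (to_torus -` (cos_torus -` S))" if "open S" for S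
  proof -
    have "to_torus -` (cos_torus -` S) = cos -` S" by auto
    then show ?thesis using that by (simp add: open_vimage continuous_on_cos)
  qed
  then show "continuous_on UNIV cos_torus"
    by (simp add: continuous_on_open_vimage open_torus_def)
qed

lemma measurable_sin_torus [measurable]: "sin_torus \<in> borel_measurable borel"
proof (rule borel_measurable_continuous_onI)
  have "open (to_torus -` (sin_torus -` S))" if "open S" for S
  proof -
    have "to_torus -` (sin_torus -` S) = sin -` S" by auto
    then show ?thesis using that by (simp add: open_vimage continuous_on_sin)
  qed
  then show "continuous_on UNIV sin_torus"
    by (simp add: continuous_on_open_vimage open_torus_def)
qed

text \<open>A Borel measurable representative in \<open>[- pi, pi]\<close>. It is expressed through \<^const>\<open>cos_torus\<close> and
  \<^const>\<open>sin_torus\<close> because \<^const>\<open>rep_torus\<close> is an arbitrary choice that need not be measurable. Clamping the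
  cosine makes the arccosine continuous on the whole real line.\<close>

definition torus_angle :: "torus \<Rightarrow> real" where
  "torus_angle x =
     (let a = arccos (max (- 1) (min 1 (cos_torus x))) in if sin_torus x \<ge> 0 then a else - a)"

lemma measurable_torus_angle [measurable]: "torus_angle \<in> borel_measurable borel"
proof -
  have "continuous_on UNIV (\<lambda>c::real. arccos (max (- 1) (min 1 c)))"
    by (intro continuous_on_compose2[OF continuous_on_arccos'] continuous_intros) auto
  then have [measurable]: "(\<lambda>c::real. arccos (max (- 1) (min 1 c))) \<in> borel_measurable borel"
    by (rule borel_measurable_continuous_onI)
  show ?thesis
    unfolding torus_angle_def Let_def by measurable
qed

lemma abs_cos_torus_le: "\<bar>cos_torus x\<bar> \<le> 1" and abs_sin_torus_le: "\<bar>sin_torus x\<bar> \<le> 1"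
  by (cases x rule: torus_cases; simp)+

lemma torus_angle_to_torus: "to_torus (torus_angle x) = x"
proof (cases x rule: torus_cases)
  fix y assume y: "x = to_torus y"
  have m: "max (- 1) (min 1 (cos y)) = cos y" by simp
  have s: "sin (arccos (cos y)) = \<bar>sin y\<bar>"
  proof -
    have "sin (arccos (cos y)) = sqrt (1 - (cos y)\<^sup>2)" by (rule sin_arccos_abs) simp
    also have "1 - (cos y)\<^sup>2 = (sin y)\<^sup>2" by (rule sin_squared_eq[symmetric])
    finally show ?thesis by simp
  qed
  show ?thesis
    unfolding torus_angle_def Let_def y to_torus_eq_iff_sin_cos cos_torus_to_torus m sin_torus_to_torus
    by (simp add: s)
qed

lemma abs_torus_angle_le: "\<bar>torus_angle x\<bar> \<le> pi"
proof -
  let ?c = "max (- 1) (min 1 (cos_torus x))"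
  have "0 \<le> arccos ?c" "arccos ?c \<le> pi"
    by (intro arccos_lbound arccos_ubound; simp)+
  then show ?thesis unfolding torus_angle_def Let_def by auto
qed

lemma space_torus_prob: "\<mu> \<in> torus_prob \<Longrightarrow> space \<mu> = UNIV"
  unfolding torus_prob_def by (auto dest: sets_eq_imp_space_eq)

lemma measurable_torus_prob: "\<mu> \<in> torus_prob \<Longrightarrow> f \<in> borel \<rightarrow>\<^sub>M N \<Longrightarrow> f \<in> \<mu> \<rightarrow>\<^sub>M N"
  unfolding torus_prob_def by (auto cong: measurable_cong_sets)

lemma integrable_torus_prob:
  fixes f :: "torus \<Rightarrow> real"
  assumes "\<mu> \<in> torus_prob" "f \<in> borel_measurable borel" "\<And>x. \<bar>f x\<bar> \<le> K"
  shows "integrable \<mu> f"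
proof -
  interpret prob_space \<mu> using assms by (simp add: torus_prob_def)
  show ?thesis
    using assms(3) measurable_torus_prob[OF assms(1,2)]
    by (intro integrable_const_bound[where B=K]) auto
qed

text \<open>If \<open>r\<close> and \<open>\<phi>\<close> are polar coordinates of the first Fourier coefficient, then \<open>r\<close> is the mean of
  \<open>cos (x - \<phi>)\<close>; the integrand is the addition formula written out.\<close>

lemma integral_rotated_cos_torus:
  assumes \<mu>: "\<mu> \<in> torus_prob"
    and polar: "(\<integral>x. cos_torus x \<partial>\<mu>) = r * cos \<phi>" "(\<integral>x. sin_torus x \<partial>\<mu>) = r * sin \<phi>"
  shows "(\<integral>x. cos_torus x * cos \<phi> + sin_torus x * sin \<phi> \<partial>\<mu>) = r"
proof -
  have "(\<integral>x. cos_torus x * cos \<phi> + sin_torus x * sin \<phi> \<partial>\<mu>)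
      = r * cos \<phi> * cos \<phi> + r * sin \<phi> * sin \<phi>"
    using integrable_torus_prob[OF \<mu> measurable_cos_torus abs_cos_torus_le]
      integrable_torus_prob[OF \<mu> measurable_sin_torus abs_sin_torus_le] by (simp add: polar)
  also have "\<dots> = r * ((cos \<phi>)\<^sup>2 + (sin \<phi>)\<^sup>2)"
    by (simp only: power2_eq_square distrib_left mult.assoc)
  finally show ?thesis by simp
qed

text \<open>Near \<open>0\<close> the left side is below \<open>e\<close> by continuity; away from \<open>0\<close> the quantity \<open>1 - cos x\<close> is bounded
  below, so a large multiple of it dominates the bounded function.\<close>

lemma torus_deviation_bound:
  fixes f :: "torus \<Rightarrow> real"
  assumes cf: "continuous_on UNIV f" and bf: "\<And>x. \<bar>f x\<bar> \<le> K" and e: "e > 0"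
  obtains C where "C \<ge> 0" "\<And>x. \<bar>f x - f 0\<bar> \<le> e + C * (1 - cos_torus x)"
proof -
  let ?g = "\<lambda>y::real. f (to_torus y)"
  have "continuous_on UNIV ?g"
    by (rule continuous_on_compose2[OF cf continuous_on_to_torus]) auto
  then have "isCont ?g 0"
    by (simp add: continuous_on_eq_continuous_at)
  then obtain d0 where d0: "d0 > 0" "\<And>y. \<bar>y\<bar> < d0 \<Longrightarrow> \<bar>?g y - ?g 0\<bar> < e"
    using e unfolding continuous_at_eps_delta dist_real_def by fastforce
  define d where "d = min d0 1"
  have d: "0 < d" "d \<le> 1" "\<And>y. \<bar>y\<bar> < d \<Longrightarrow> \<bar>?g y - ?g 0\<bar> < e"
    using d0 by (auto simp: d_def)
  have pi: "d < pi" using d pi_gt3 by linarith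
  have cd: "cos d < 1" using d pi cos_monotone_0_pi[of 0 d] by simp
  have K: "K \<ge> 0" using bf[of 0] by linarith
  define C where "C = 2 * K / (1 - cos d)"
  show ?thesis
  proof
    show C0: "C \<ge> 0" using K cd by (simp add: C_def)
    fix x
    define y where "y = torus_angle x"
    have y: "x = to_torus y" "\<bar>y\<bar> \<le> pi"
      by (simp_all add: y_def torus_angle_to_torus abs_torus_angle_le)
    have z: "(0::torus) = to_torus 0" by (simp add: zero_torus.abs_eq)
    show "\<bar>f x - f 0\<bar> \<le> e + C * (1 - cos_torus x)"
    proof (cases "\<bar>y\<bar> < d")
      case True
      have "C * (1 - cos y) \<ge> 0" using C0 by simp
      then show ?thesis using d(3)[OF True] by (simp add: y(1) z)
    next
      case False
      have "cos y \<le> cos d"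
        using cos_monotone_0_pi_le[of d "\<bar>y\<bar>"] False y(2) d by simp
      then have "C * (1 - cos d) \<le> C * (1 - cos y)"
        using C0 by (intro mult_left_mono) auto
      then have "2 * K \<le> C * (1 - cos y)" using cd by (simp add: C_def)
      moreover have "\<bar>f x - f 0\<bar> \<le> 2 * K" using bf[of x] bf[of 0] by linarith
      ultimately show ?thesis using e by (simp add: y(1))
    qed
  qed
qed

lemma converges_in_law_dirac_if_cos_tendsto_1:
  assumes \<nu>: "\<And>n. \<nu> n \<in> torus_prob"
    and lim: "(\<lambda>n. \<integral>x. cos_torus x \<partial>\<nu> n) \<longlonglongrightarrow> 1"
  shows "converges_in_law \<nu> (return borel 0)"
  unfolding converges_in_law_def
proof (intro allI impI, elim conjE)
  fix f :: "torus \<Rightarrow> real"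
  assume cf: "continuous_on UNIV f" and "bounded (range f)"
  then obtain K where K: "\<And>x. \<bar>f x\<bar> \<le> K"
    unfolding bounded_iff by auto
  have fm: "f \<in> borel_measurable borel" by (rule borel_measurable_continuous_onI[OF cf])
  have r: "(\<integral>x. f x \<partial>return borel 0) = f 0"
    using fm by (simp add: integral_return)
  have "(\<lambda>n. \<integral>x. f x \<partial>\<nu> n) \<longlonglongrightarrow> f 0"
  proof (rule LIMSEQ_I)
    fix e :: real assume "e > 0"
    then have e2: "e / 2 > 0" by simp
    obtain C where C: "C \<ge> 0" "\<And>x. \<bar>f x - f 0\<bar> \<le> e / 2 + C * (1 - cos_torus x)"
      using torus_deviation_bound[OF cf K e2] by blast
    have b: "\<bar>(\<integral>x. f x \<partial>\<nu> n) - f 0\<bar> \<le> e / 2 + C * (1 - (\<integral>x. cos_torus x \<partial>\<nu> n))" for n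
    proof -
      interpret prob_space "\<nu> n" using \<nu> by (simp add: torus_prob_def)
      have fi: "integrable (\<nu> n) f" by (rule integrable_torus_prob[OF \<nu> fm K])
      have ci: "integrable (\<nu> n) cos_torus"
        by (rule integrable_torus_prob[OF \<nu> _ abs_cos_torus_le]) simp
      have "\<bar>(\<integral>x. f x \<partial>\<nu> n) - f 0\<bar> = \<bar>\<integral>x. f x - f 0 \<partial>\<nu> n\<bar>"
        using fi by (simp add: prob_space)
      also have "\<dots> \<le> (\<integral>x. \<bar>f x - f 0\<bar> \<partial>\<nu> n)"
        by (rule integral_abs_bound)
      also have "\<dots> \<le> (\<integral>x. e / 2 + C * (1 - cos_torus x) \<partial>\<nu> n)"
        using fi ci C(2) by (intro integral_mono) auto
      also have "\<dots> = e / 2 + C * (1 - (\<integral>x. cos_torus x \<partial>\<nu> n))"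
        using ci by (simp add: prob_space)
      finally show ?thesis .
    qed
    have "(\<lambda>n. C * (1 - (\<integral>x. cos_torus x \<partial>\<nu> n))) \<longlonglongrightarrow> C * (1 - 1)"
      by (intro tendsto_intros lim)
    then have "(\<lambda>n. C * (1 - (\<integral>x. cos_torus x \<partial>\<nu> n))) \<longlonglongrightarrow> 0" by simp
    then obtain N where N: "\<And>n. n \<ge> N \<Longrightarrow> \<bar>C * (1 - (\<integral>x. cos_torus x \<partial>\<nu> n))\<bar> < e / 2"
      using LIMSEQ_D[OF _ e2] by fastforce
    show "\<exists>N. \<forall>n\<ge>N. norm ((\<integral>x. f x \<partial>\<nu> n) - f 0) < e"
    proof (intro exI allI impI)
      fix n assume "n \<ge> N"
      then show "norm ((\<integral>x. f x \<partial>\<nu> n) - f 0) < e"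
        using b[of n] N[of n] by auto
    qed
  qed
  then show "(\<lambda>n. \<integral>x. f x \<partial>\<nu> n) \<longlonglongrightarrow> (\<integral>x. f x \<partial>return borel 0)"
    by (simp add: r)
qed

lemma translate_torus_prob:
  assumes "\<mu> \<in> torus_prob" shows "translate \<mu> x \<in> torus_prob"
proof -
  interpret prob_space \<mu> using assms by (simp add: torus_prob_def)
  have "(\<lambda>z. x + z) \<in> \<mu> \<rightarrow>\<^sub>M borel"
    by (rule measurable_torus_prob[OF assms borel_measurable_continuous_onI[OF continuous_on_torus_add]])
  then show ?thesis
    unfolding torus_prob_def translate_def by (simp add: prob_space_distr)
qed

text \<open>Translating by minus the argument of the first Fourier coefficient makes the coefficient real.\<close>

lemma torus_prob_order_parameter:
  assumes \<mu>: "\<mu> \<in> torus_prob"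
  obtains r \<phi> where "0 \<le> r" "r \<le> 1"
    "(\<integral>x. cos_torus x \<partial>\<mu>) = r * cos \<phi>" "(\<integral>x. sin_torus x \<partial>\<mu>) = r * sin \<phi>"
    "(\<integral>x. cos_torus x \<partial>translate \<mu> (to_torus (- \<phi>))) = r"
proof -
  interpret prob_space \<mu> using \<mu> by (simp add: torus_prob_def)
  define w where "w = Complex (\<integral>x. cos_torus x \<partial>\<mu>) (\<integral>x. sin_torus x \<partial>\<mu>)"
  define r \<phi> where "r = cmod w" and "\<phi> = Arg w"
  have w: "w = rcis r \<phi>" by (simp add: r_def \<phi>_def rcis_cmod_Arg)
  have c: "(\<integral>x. cos_torus x \<partial>\<mu>) = r * cos \<phi>" and s: "(\<integral>x. sin_torus x \<partial>\<mu>) = r * sin \<phi>"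
    using arg_cong[OF w, of Re] arg_cong[OF w, of Im] by (simp_all add: w_def)
  have m: "(\<lambda>z. to_torus (- \<phi>) + z) \<in> \<mu> \<rightarrow>\<^sub>M borel"
    by (rule measurable_torus_prob[OF \<mu> borel_measurable_continuous_onI[OF continuous_on_torus_add]])
  have ct: "cos_torus (to_torus (- \<phi>) + x) = cos \<phi> * cos_torus x + sin \<phi> * sin_torus x" for x
    by (cases x rule: torus_cases) (simp add: cos_diff flip: to_torus_add)
  have t: "(\<integral>x. cos_torus x \<partial>translate \<mu> (to_torus (- \<phi>))) = r"
  proof -
    have "(\<integral>x. cos_torus x \<partial>translate \<mu> (to_torus (- \<phi>))) = (\<integral>x. cos_torus (to_torus (- \<phi>) + x) \<partial>\<mu>)"
      unfolding translate_def by (rule integral_distr[OF m]) simp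
    also have "\<dots> = r"
      unfolding ct using integral_rotated_cos_torus[OF \<mu> c s] by (simp only: mult.commute)
    finally show ?thesis .
  qed
  have "r \<le> 1"
  proof -
    interpret T: prob_space "translate \<mu> (to_torus (- \<phi>))"
      using translate_torus_prob[OF \<mu>] by (simp add: torus_prob_def)
    have "(\<integral>x. cos_torus x \<partial>translate \<mu> (to_torus (- \<phi>))) \<le> (\<integral>x. 1 \<partial>translate \<mu> (to_torus (- \<phi>)))"
      using abs_cos_torus_le
      by (intro integral_mono integrable_torus_prob[OF translate_torus_prob[OF \<mu>], where K=1]) (auto simp: abs_le_iff)
    then show ?thesis by (simp add: t T.prob_space)
  qed
  moreover have "0 \<le> r" by (simp add: r_def)
  ultimately show ?thesis using that c s t by blast
qed

section \<open>Brownian increments relative to a filtration\<close>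

text \<open>The process is the pointwise limit of its time discretisations, which are countable case
  distinctions.\<close>

lemma borel_measurable_pair_continuous_paths:
  fixes X :: "real \<Rightarrow> 'w \<Rightarrow> real"
  assumes X: "\<And>t. X t \<in> borel_measurable M"
    and c: "\<And>\<omega>. \<omega> \<in> space M \<Longrightarrow> continuous_on UNIV (\<lambda>t. X t \<omega>)"
  shows "(\<lambda>(t, \<omega>). X t \<omega>) \<in> borel_measurable (borel \<Otimes>\<^sub>M M)"
proof (rule borel_measurable_LIMSEQ_real)
  let ?q = "\<lambda>n t. of_int \<lfloor>real (Suc n) * t\<rfloor> / real (Suc n)"
  fix p :: "real \<times> 'w" assume "p \<in> space (borel \<Otimes>\<^sub>M M)"
  then obtain t \<omega> where p: "p = (t, \<omega>)" "\<omega> \<in> space M"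
    by (cases p) (auto simp: space_pair_measure)
  have q: "(\<lambda>n. ?q n t) \<longlonglongrightarrow> t"
  proof (rule real_tendsto_sandwich[where f="\<lambda>n. t - inverse (real (Suc n))" and h="\<lambda>_. t"])
    have b: "t - inverse m \<le> of_int \<lfloor>m * t\<rfloor> / m \<and> of_int \<lfloor>m * t\<rfloor> / m \<le> t" if "m > 0" for m :: real
    proof -
      have "m * t - 1 \<le> of_int \<lfloor>m * t\<rfloor>" "of_int \<lfloor>m * t\<rfloor> \<le> m * t" by linarith+
      then have "(m * t - 1) / m \<le> of_int \<lfloor>m * t\<rfloor> / m" "of_int \<lfloor>m * t\<rfloor> / m \<le> m * t / m"
        using divide_right_mono[OF _ less_imp_le[OF that]] by blast+
      moreover have "(m * t - 1) / m = t - inverse m" "m * t / m = t"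
        using that by (simp_all add: diff_divide_distrib inverse_eq_divide)
      ultimately show ?thesis by metis
    qed
    have "t - inverse (real (Suc n)) \<le> ?q n t" for n
      using b[of "real (Suc n)"] by simp
    then show "\<forall>\<^sub>F n in sequentially. t - inverse (real (Suc n)) \<le> ?q n t" by simp
    have "?q n t \<le> t" for n
      using b[of "real (Suc n)"] by simp
    then show "\<forall>\<^sub>F n in sequentially. ?q n t \<le> t" by simp
    show "(\<lambda>n. t - inverse (real (Suc n))) \<longlonglongrightarrow> t"
      using tendsto_diff[OF tendsto_const LIMSEQ_inverse_real_of_nat, of t] by simp
  qed simp
  have "isCont (\<lambda>t. X t \<omega>) t"
    using c[OF p(2)] by (simp add: continuous_on_eq_continuous_at)
  then show "(\<lambda>n. (\<lambda>(t, \<omega>). X (?q n t) \<omega>) p) \<longlonglongrightarrow> (\<lambda>(t, \<omega>). X t \<omega>) p"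
    using isCont_tendsto_compose[OF _ q] by (simp add: p)
next
  fix n
  show "(\<lambda>(t, \<omega>). X (of_int \<lfloor>real (Suc n) * t\<rfloor> / real (Suc n)) \<omega>) \<in> borel_measurable (borel \<Otimes>\<^sub>M M)"
    unfolding split_beta'
    by (rule measurable_compose_countable[where g="\<lambda>p. \<lfloor>real (Suc n) * fst p\<rfloor>" 
          and f="\<lambda>k p. X (of_int k / real (Suc n)) (snd p)"])
       (use X in measurable)
qed

locale filtered_brownian = prob_space M
  for M :: "'w measure" and F :: "real \<Rightarrow> 'w measure" and B :: "real \<Rightarrow> 'w \<Rightarrow> real" +
  assumes filtered: "filtered_prob_space M F" and brownian: "brownian_motion M F B"
begin

lemma space_F: "t \<ge> 0 \<Longrightarrow> space (F t) = space M"
  using filtered unfolding filtered_prob_space_def subalgebra_def by blast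

lemma measurable_F: "V \<in> F t \<rightarrow>\<^sub>M N \<Longrightarrow> t \<ge> 0 \<Longrightarrow> V \<in> M \<rightarrow>\<^sub>M N"
  using filtered measurable_from_subalg unfolding filtered_prob_space_def by blast

lemma measurable_F_mono: "V \<in> F s \<rightarrow>\<^sub>M N \<Longrightarrow> 0 \<le> s \<Longrightarrow> s \<le> t \<Longrightarrow> V \<in> F t \<rightarrow>\<^sub>M N"
proof -
  assume V: "V \<in> F s \<rightarrow>\<^sub>M N" and st: "0 \<le> s" "s \<le> t"
  have "subalgebra (F t) (F s)"
    using filtered st space_F unfolding filtered_prob_space_def subalgebra_def by auto
  then show ?thesis using V measurable_from_subalg by blast
qed

lemma B_measurable_F: "t \<ge> 0 \<Longrightarrow> B t \<in> borel_measurable (F t)"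
  using brownian unfolding brownian_motion_def by blast

lemma B_measurable: "t \<ge> 0 \<Longrightarrow> B t \<in> borel_measurable M"
  using measurable_F[OF B_measurable_F] by blast

lemma B_0: "AE \<omega> in M. B 0 \<omega> = 0"
  using brownian unfolding brownian_motion_def by blast

lemma B_pair_measurable: "(\<lambda>(t, \<omega>). B (max 0 t) \<omega>) \<in> borel_measurable (borel \<Otimes>\<^sub>M M)"
proof (rule borel_measurable_pair_continuous_paths[where X="\<lambda>t. B (max 0 t)"])
  show "B (max 0 t) \<in> borel_measurable M" for t by (rule B_measurable) simp
  show "continuous_on UNIV (\<lambda>t. B (max 0 t) \<omega>)" if "\<omega> \<in> space M" for \<omega>
  proof (rule continuous_on_compose2[where g="\<lambda>t. B t \<omega>" and f="max 0" and t="{0..}"])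
    show "continuous_on {0..} (\<lambda>t. B t \<omega>)"
      using brownian that unfolding brownian_motion_def by blast
  qed (auto intro!: continuous_intros)
qed

lemma B_increment_distributed:
  assumes "0 \<le> s" "s < t"
  shows "distributed M lborel (\<lambda>\<omega>. B t \<omega> - B s \<omega>) (normal_density 0 (sqrt (t - s)))"
  using brownian assms unfolding brownian_motion_def by blast

lemma B_increment_indep:
  assumes st: "0 \<le> s" "s < t" and V: "V \<in> F s \<rightarrow>\<^sub>M N"
  shows "indep_var N V borel (\<lambda>\<omega>. B t \<omega> - B s \<omega>)"
proof -
  let ?D = "\<lambda>\<omega>. B t \<omega> - B s \<omega>"
  have i: "indep_set (sets (F s)) (sets (vimage_algebra (space M) ?D borel))"
    using brownian st unfolding brownian_motion_def by blast
  have D: "?D \<in> borel_measurable M"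
    using st by (intro borel_measurable_diff B_measurable) auto
  have 1: "sigma_sets (space M) {V -` A \<inter> space M |A. A \<in> sets N} \<subseteq> sets (F s)"
  proof -
    have "sigma_sets (space (F s)) {V -` A \<inter> space (F s) |A. A \<in> sets N} \<subseteq> sets (F s)"
      by (rule sets.sigma_sets_subset) (use measurable_sets[OF V] in auto)
    then show ?thesis using space_F st by simp
  qed
  have 2: "sigma_sets (space M) {?D -` A \<inter> space M |A. A \<in> sets borel}
      \<subseteq> sets (vimage_algebra (space M) ?D borel)"
    by (subst sets_vimage_algebra) simp
  show ?thesis
    unfolding indep_var_eq indep_set_def
  proof (intro conjI)
    show "indep_sets (case_bool (sigma_sets (space M) {V -` A \<inter> space M |A. A \<in> sets N})
        (sigma_sets (space M) {?D -` A \<inter> space M |A. A \<in> sets borel})) UNIV"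
      by (rule indep_sets_mono_sets[OF i[unfolded indep_set_def]]) (use 1 2 in \<open>auto split: bool.split\<close>)
  qed (use measurable_F[OF V] D st in auto)
qed

lemma increment_std_normal:
  assumes st: "0 \<le> s" "s < t"
  shows "distr M borel (\<lambda>\<omega>. (B t \<omega> - B s \<omega>) / sqrt (t - s)) = std_normal_distribution"
proof -
  have "distributed M lborel (\<lambda>\<omega>. (B t \<omega> - B s \<omega>) / sqrt (t - s)) std_normal_density"
    using normal_standard_normal_convert[of "sqrt (t - s)" _ 0] B_increment_distributed[OF st] st
    by simp
  from distributed_distr_eq_density[OF this] show ?thesis by (simp cong: distr_cong)
qed

lemma
  assumes st: "0 \<le> s" "s < t"
  shows expectation_cos_increment:
      "expectation (\<lambda>\<omega>. cos (a * (B t \<omega> - B s \<omega>))) = exp (- a\<^sup>2 * (t - s) / 2)"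
    and expectation_sin_increment:
      "expectation (\<lambda>\<omega>. sin (a * (B t \<omega> - B s \<omega>))) = 0"
proof -
  define c where "c = sqrt (t - s)"
  have c: "c > 0" "c\<^sup>2 = t - s" using st by (auto simp: c_def)
  let ?Z = "\<lambda>\<omega>. (B t \<omega> - B s \<omega>) / c"
  have d: "distr M borel ?Z = std_normal_distribution"
    using increment_std_normal[OF st] by (simp add: c_def)
  have Zm: "?Z \<in> borel_measurable M"
    using st by (intro borel_measurable_divide borel_measurable_diff B_measurable) auto
  have "(\<integral>x. iexp (a * c * x) \<partial>std_normal_distribution) = complex_of_real (exp (- ((a * c)\<^sup>2) / 2))"
    using fun_cong[OF char_std_normal_distribution, of "a * c"] by (simp add: char_def)
  then have e: "expectation (\<lambda>\<omega>. iexp (a * c * ?Z \<omega>)) = complex_of_real (exp (- ((a * c)\<^sup>2) / 2))"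
    unfolding d[symmetric] by (subst (asm) integral_distr[OF Zm]) simp_all
  have z: "a * c * ?Z \<omega> = a * (B t \<omega> - B s \<omega>)" for \<omega> using c by simp
  have int: "complex_integrable M (\<lambda>\<omega>. iexp (a * (B t \<omega> - B s \<omega>)))"
    by (rule integrable_const_bound[where B=1]) (use B_measurable st in \<open>auto simp: norm_exp_eq_Re\<close>)
  have e': "expectation (\<lambda>\<omega>. iexp (a * (B t \<omega> - B s \<omega>))) = complex_of_real (exp (- ((a * c)\<^sup>2) / 2))"
    using e unfolding z .
  show "expectation (\<lambda>\<omega>. cos (a * (B t \<omega> - B s \<omega>))) = exp (- a\<^sup>2 * (t - s) / 2)"
    using integral_Re[OF int] unfolding e' by (simp add: Re_exp c power_mult_distrib)
  show "expectation (\<lambda>\<omega>. sin (a * (B t \<omega> - B s \<omega>))) = 0"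
    using integral_Im[OF int] unfolding e' by (simp add: Im_exp)
qed

lemma
  assumes s0: "0 \<le> s" and le: "s \<le> t"
  shows expectation_increment_square: "expectation (\<lambda>\<omega>. (B t \<omega> - B s \<omega>)\<^sup>2) = t - s"
    and integrable_increment_square: "integrable M (\<lambda>\<omega>. (B t \<omega> - B s \<omega>)\<^sup>2)"
proof -
  have "integrable M (\<lambda>\<omega>. (B t \<omega> - B s \<omega>)\<^sup>2) \<and> expectation (\<lambda>\<omega>. (B t \<omega> - B s \<omega>)\<^sup>2) = t - s"
  proof (cases "s = t")
    case True
    then show ?thesis by simp
  next
    case False
    then have st: "s < t" using le by simp
    note D = B_increment_distributed[OF s0 st]
    have "integrable lborel (\<lambda>x. normal_density 0 (sqrt (t - s)) x * x\<^sup>2)"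
      using integrable_normal_moment[of "sqrt (t - s)" 0 2] st by simp
    moreover have "(\<integral>x. normal_density 0 (sqrt (t - s)) x * x\<^sup>2 \<partial>lborel)
        = expectation (\<lambda>\<omega>. (B t \<omega> - B s \<omega>)\<^sup>2)"
      using distributed_integral[OF D, of "\<lambda>x. x\<^sup>2"] by simp
    ultimately show ?thesis
      using distributed_integrable[OF D, of "\<lambda>x. x\<^sup>2"]
        integral_normal_moment_even[of "sqrt (t - s)" 0 1] st
      by (simp add: power2_eq_square fact_numeral)
  qed
  then show "expectation (\<lambda>\<omega>. (B t \<omega> - B s \<omega>)\<^sup>2) = t - s"
    and "integrable M (\<lambda>\<omega>. (B t \<omega> - B s \<omega>)\<^sup>2)" by simp_all
qed

text \<open>An independent Gaussian increment damps every cosine by its characteristic function. The weight \<open>G\<close>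
  and the phase \<open>V\<close> may be any variables known at time \<open>s\<close>; replacing \<open>V\<close> by \<open>V - pi / 2\<close> gives the same
  formula for the sine. All moments of the test controls that involve the noise nonlinearly come from this
  identity.\<close>

lemma expectation_weighted_cos_add_increment:
  assumes s0: "0 \<le> s" and le: "s \<le> t"
    and V: "V \<in> borel_measurable (F s)" and G: "G \<in> borel_measurable (F s)"
    and K: "\<And>\<omega>. \<omega> \<in> space M \<Longrightarrow> \<bar>G \<omega>\<bar> \<le> K"
  shows "expectation (\<lambda>\<omega>. G \<omega> * cos (V \<omega> + a * (B t \<omega> - B s \<omega>)))
       = exp (- a\<^sup>2 * (t - s) / 2) * expectation (\<lambda>\<omega>. G \<omega> * cos (V \<omega>))"
proof (cases "s = t")
  case True
  then show ?thesis by simp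
next
  case False
  with s0 le have st: "0 \<le> s" "s < t" by auto
  let ?D = "\<lambda>\<omega>. B t \<omega> - B s \<omega>"
  have Gc: "(\<lambda>\<omega>. G \<omega> * cos (V \<omega>)) \<in> borel_measurable (F s)"
    and Gs: "(\<lambda>\<omega>. G \<omega> * sin (V \<omega>)) \<in> borel_measurable (F s)"
    using V G by measurable
  note [measurable] = measurable_F[OF V st(1)] measurable_F[OF G st(1)]
  have [measurable]: "B t \<in> borel_measurable M" "B s \<in> borel_measurable M"
    using st by (auto intro: B_measurable)
  have K0: "\<bar>x * y\<bar> \<le> K" if "\<bar>x\<bar> \<le> K" "\<bar>y\<bar> \<le> 1" for x y :: real
    using mult_mono[OF that] that by (simp add: abs_mult)
  have iGc: "integrable M (\<lambda>\<omega>. G \<omega> * cos (V \<omega>))"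
    and iGs: "integrable M (\<lambda>\<omega>. G \<omega> * sin (V \<omega>))"
    by (rule integrable_const_bound[where B=K]; use K K0 in auto)+
  have ic: "integrable M (\<lambda>\<omega>. cos (a * ?D \<omega>))" and isn: "integrable M (\<lambda>\<omega>. sin (a * ?D \<omega>))"
    by (rule integrable_const_bound[where B=1]; auto)+
  have indc: "indep_var borel (\<lambda>\<omega>. G \<omega> * cos (V \<omega>)) borel (\<lambda>\<omega>. cos (a * ?D \<omega>))"
    using indep_var_compose[OF B_increment_indep[OF st Gc], of "\<lambda>x. x" borel "\<lambda>x. cos (a * x)" borel]
    by (simp add: comp_def)
  have inds: "indep_var borel (\<lambda>\<omega>. G \<omega> * sin (V \<omega>)) borel (\<lambda>\<omega>. sin (a * ?D \<omega>))"
    using indep_var_compose[OF B_increment_indep[OF st Gs], of "\<lambda>x. x" borel "\<lambda>x. sin (a * x)" borel]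
    by (simp add: comp_def)
  have "expectation (\<lambda>\<omega>. G \<omega> * cos (V \<omega> + a * ?D \<omega>))
      = expectation (\<lambda>\<omega>. (G \<omega> * cos (V \<omega>)) * cos (a * ?D \<omega>) - (G \<omega> * sin (V \<omega>)) * sin (a * ?D \<omega>))"
    by (simp add: cos_add right_diff_distrib mult.assoc)
  also have "\<dots> = expectation (\<lambda>\<omega>. (G \<omega> * cos (V \<omega>)) * cos (a * ?D \<omega>))
      - expectation (\<lambda>\<omega>. (G \<omega> * sin (V \<omega>)) * sin (a * ?D \<omega>))"
    by (intro Bochner_Integration.integral_diff indep_var_integrable indc inds iGc iGs ic isn)
  also have "\<dots> = expectation (\<lambda>\<omega>. G \<omega> * cos (V \<omega>)) * expectation (\<lambda>\<omega>. cos (a * ?D \<omega>))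
      - expectation (\<lambda>\<omega>. G \<omega> * sin (V \<omega>)) * expectation (\<lambda>\<omega>. sin (a * ?D \<omega>))"
    by (simp only: indep_var_lebesgue_integral[OF indc iGc ic] indep_var_lebesgue_integral[OF inds iGs isn])
  finally show ?thesis
    by (simp add: expectation_cos_increment[OF st] expectation_sin_increment[OF st])
qed

end

section \<open>Laws invariant under Brownian noise are uniform\<close>

text \<open>Continuity of translation in \<open>L\<^sup>1\<close>, by dominated convergence: bounded shifts of the standard normal density
  lie below a multiple of the wider density with variance \<open>2\<close>.\<close>

lemma std_normal_density_shift_L1:
  fixes a :: "nat \<Rightarrow> real"
  assumes a: "a \<longlonglongrightarrow> 0"
  shows "(\<lambda>n. \<integral>z. \<bar>std_normal_density (z - a n) - std_normal_density z\<bar> \<partial>lborel) \<longlonglongrightarrow> 0"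
proof -
  obtain A where A: "\<And>n. \<bar>a n\<bar> \<le> A"
    using convergent_imp_Bseq[OF convergentI[OF a]] unfolding Bseq_def by auto
  let ?w = "\<lambda>z. sqrt 2 * exp (A\<^sup>2 / 2) * normal_density 0 (sqrt 2) z"
  have w: "std_normal_density (z - b) \<le> ?w z" if "\<bar>b\<bar> \<le> A" for z b
  proof -
    have "b\<^sup>2 \<le> A\<^sup>2" using that by (rule abs_le_square_iff[THEN iffD1, OF order_trans[OF _ abs_ge_self]])
    moreover have "0 \<le> (z / 2 - b)\<^sup>2" by simp
    ultimately have "- (z - b)\<^sup>2 / 2 \<le> A\<^sup>2 / 2 + - z\<^sup>2 / 4"
      unfolding power2_diff power_divide by simp
    then have "exp (- (z - b)\<^sup>2 / 2) \<le> exp (A\<^sup>2 / 2) * exp (- z\<^sup>2 / 4)"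
      by (simp flip: exp_add)
    then have "exp (- (z - b)\<^sup>2 / 2) / sqrt (2 * pi) \<le> exp (A\<^sup>2 / 2) * exp (- z\<^sup>2 / 4) / sqrt (2 * pi)"
      by (rule divide_right_mono) simp
    moreover have c: "sqrt 2 * (1 / sqrt (2 * pi * (sqrt 2)\<^sup>2)) = 1 / sqrt (2 * pi)"
      by (simp add: real_sqrt_mult frac_eq_eq flip: mult.assoc)
    have "?w z = (sqrt 2 * (1 / sqrt (2 * pi * (sqrt 2)\<^sup>2))) * (exp (A\<^sup>2 / 2) * exp (- z\<^sup>2 / 4))"
      by (simp add: normal_density_def)
    then have "?w z = exp (A\<^sup>2 / 2) * exp (- z\<^sup>2 / 4) / sqrt (2 * pi)"
      unfolding c by simp
    moreover have "std_normal_density (z - b) = exp (- (z - b)\<^sup>2 / 2) / sqrt (2 * pi)"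
      by (simp add: std_normal_density_def)
    ultimately show ?thesis by (simp only:)
  qed
  have A0: "A \<ge> 0" using A[of 0] by linarith
  have "(\<lambda>n. \<integral>z. \<bar>std_normal_density (z - a n) - std_normal_density z\<bar> \<partial>lborel)
      \<longlonglongrightarrow> (\<integral>z. 0 \<partial>(lborel :: real measure))"
  proof (rule integral_dominated_convergence[where w="\<lambda>z. 2 * ?w z"])
    show "AE z in lborel. (\<lambda>n. \<bar>std_normal_density (z - a n) - std_normal_density z\<bar>) \<longlonglongrightarrow> 0"
    proof (rule AE_I2)
      fix z :: real
      have "isCont std_normal_density z" unfolding std_normal_density_def by (intro continuous_intros) auto
      moreover have "(\<lambda>n. z - a n) \<longlonglongrightarrow> z" using tendsto_diff[OF tendsto_const a, of z] by simp
      ultimately have "(\<lambda>n. std_normal_density (z - a n)) \<longlonglongrightarrow> std_normal_density z"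
        by (rule isCont_tendsto_compose)
      then show "(\<lambda>n. \<bar>std_normal_density (z - a n) - std_normal_density z\<bar>) \<longlonglongrightarrow> 0"
        by (intro tendsto_rabs_zero LIM_zero)
    qed
    show "AE z in lborel. norm \<bar>std_normal_density (z - a n) - std_normal_density z\<bar> \<le> 2 * ?w z" for n
    proof (rule AE_I2)
      fix z :: real
      have "std_normal_density (z - a n) \<le> ?w z" "std_normal_density z \<le> ?w z"
        using w[OF A, of z n] w[of 0 z] A0 by simp_all
      then show "norm \<bar>std_normal_density (z - a n) - std_normal_density z\<bar> \<le> 2 * ?w z"
        using normal_density_nonneg[of 0 1 z] normal_density_nonneg[of 0 1 "z - a n"]
        unfolding real_norm_def abs_idempotent abs_le_iff by linarith
    qed
  qed auto
  then show ?thesis by simp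
qed

interpretation std_normal: prob_space std_normal_distribution
  by (rule prob_space_normal_density) simp

definition gauss_avg :: "(real \<Rightarrow> real) \<Rightarrow> real \<Rightarrow> real \<Rightarrow> real" where
  "gauss_avg f c x = (\<integral>z. f (x + c * z) \<partial>std_normal_distribution)"

lemma gauss_avg_measurable [measurable]:
  assumes [measurable]: "f \<in> borel_measurable borel"
  shows "gauss_avg f c \<in> borel_measurable borel"
  unfolding gauss_avg_def by measurable

lemma abs_gauss_avg_le:
  assumes [measurable]: "f \<in> borel_measurable borel" and f: "\<And>x. \<bar>f x\<bar> \<le> 1"
  shows "\<bar>gauss_avg f c x\<bar> \<le> 1"
proof -
  have i: "integrable std_normal_distribution (\<lambda>z. f (x + c * z))"
    by (rule std_normal.integrable_const_bound[where B=1]) (use f in auto)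
  have "\<bar>gauss_avg f c x\<bar> \<le> (\<integral>z. \<bar>f (x + c * z)\<bar> \<partial>std_normal_distribution)"
    unfolding gauss_avg_def by (rule integral_abs_bound)
  also have "\<dots> \<le> (\<integral>z. 1 \<partial>std_normal_distribution)"
    using f i by (intro integral_mono) auto
  finally show ?thesis using std_normal.prob_space by simp
qed

text \<open>Moving the centre of a Gaussian of standard deviation \<open>c\<close> by \<open>x\<close> is, after rescaling, a shift of the
  standard Gaussian by \<open>x / c\<close>. Hence the average of a bounded function forgets its starting point
  when \<open>c\<close> tends to infinity, without any regularity of the function.\<close>

lemma gauss_avg_asymptotically_constant:
  fixes c :: "nat \<Rightarrow> real"
  assumes [measurable]: "f \<in> borel_measurable borel" and f: "\<And>x. \<bar>f x\<bar> \<le> 1"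
    and c: "filterlim c at_top sequentially" "\<And>n. c n > 0"
  shows "(\<lambda>n. gauss_avg f (c n) x - gauss_avg f (c n) 0) \<longlonglongrightarrow> 0"
proof (rule Lim_null_comparison)
  let ?I = "\<lambda>b. \<integral>z. \<bar>std_normal_density (z - b) - std_normal_density z\<bar> \<partial>lborel"
  show "(\<lambda>n. ?I (x / c n)) \<longlonglongrightarrow> 0"
  proof (rule std_normal_density_shift_L1)
    show "(\<lambda>n. x / c n) \<longlonglongrightarrow> 0"
      by (rule tendsto_divide_0[OF tendsto_const filterlim_at_top_imp_at_infinity[OF c(1)]])
  qed
  have "norm (gauss_avg f (c n) x - gauss_avg f (c n) 0) \<le> ?I (x / c n)" for n
  proof -
    let ?b = "x / c n"
    have n0: "integrable lborel (\<lambda>z. std_normal_density (z - b))" for b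
      using lborel_integrable_real_affine_iff[of 1 std_normal_density "- b"] by simp
    have fi: "integrable lborel (\<lambda>z. std_normal_density (z - b) * f (c n * z))" for b
      by (rule Bochner_Integration.integrable_bound[OF n0[of b]])
         (use f in \<open>auto intro!: AE_I2 mult_left_le simp: abs_mult\<close>)
    have e: "gauss_avg f (c n) y = (\<integral>z. std_normal_density (z - y / c n) * f (c n * z) \<partial>lborel)" for y
    proof -
      have "gauss_avg f (c n) y = (\<integral>z. std_normal_density z * f (y + c n * z) \<partial>lborel)"
        unfolding gauss_avg_def by (subst integral_density) auto
      also have "\<dots> = (\<integral>z. std_normal_density (z - y / c n) * f (c n * z) \<partial>lborel)"
        using c(2)[of n]
        by (subst lborel_integral_real_affine[of 1 _ "- (y / c n)"]) (auto simp: algebra_simps)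
      finally show ?thesis .
    qed
    have "gauss_avg f (c n) x - gauss_avg f (c n) 0
        = (\<integral>z. (std_normal_density (z - ?b) - std_normal_density z) * f (c n * z) \<partial>lborel)"
      unfolding e left_diff_distrib using fi[of ?b] fi[of 0] by simp
    also have "norm \<dots> \<le> ?I ?b"
    proof (rule Bochner_Integration.integral_norm_bound_integral)
      show "integrable lborel (\<lambda>z. (std_normal_density (z - ?b) - std_normal_density z) * f (c n * z))"
        unfolding left_diff_distrib using fi[of ?b] fi[of 0] by simp
      show "integrable lborel (\<lambda>z. \<bar>std_normal_density (z - ?b) - std_normal_density z\<bar>)"
        using n0[of ?b] n0[of 0] by simp
    qed (use f in \<open>auto intro!: mult_left_le simp: abs_mult\<close>)
    finally show ?thesis .
  qed
  then show "\<forall>\<^sub>F n in sequentially. norm (gauss_avg f (c n) x - gauss_avg f (c n) 0) \<le> ?I (x / c n)"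
    by simp
qed

text \<open>If averaging over wider and wider Gaussians does not change the mean under \<open>N\<close>, this mean is the limit
  of the averages started from \<open>0\<close>, which does not mention \<open>N\<close>. Two invariant laws therefore agree.\<close>

lemma gauss_avg_tendsto_if_invariant:
  fixes c :: "nat \<Rightarrow> real"
  assumes fm [measurable]: "f \<in> borel_measurable borel" and f: "\<And>x. \<bar>f x\<bar> \<le> 1"
    and c: "filterlim c at_top sequentially" "\<And>n. c n > 0"
    and N: "prob_space N" "sets N = sets borel"
    and v: "\<And>n. (\<integral>x. gauss_avg f (c n) x \<partial>N) = v"
  shows "(\<lambda>n. gauss_avg f (c n) 0) \<longlonglongrightarrow> v"
proof -
  interpret N: prob_space N by fact
  have [measurable_cong]: "sets N = sets borel" by fact
  have m [measurable]: "gauss_avg f (c n) \<in> borel_measurable N" for n by measurable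
  have i: "integrable N (gauss_avg f (c n))" for n
    by (rule N.integrable_const_bound[where B=1]) (use abs_gauss_avg_le[OF fm f] in auto)
  have "(\<lambda>n. \<integral>x. gauss_avg f (c n) x - gauss_avg f (c n) 0 \<partial>N) \<longlonglongrightarrow> (\<integral>x. 0 \<partial>N)"
  proof (rule integral_dominated_convergence[where w="\<lambda>_. 2"])
    show "AE x in N. (\<lambda>n. gauss_avg f (c n) x - gauss_avg f (c n) 0) \<longlonglongrightarrow> 0"
      using gauss_avg_asymptotically_constant[OF fm f c] by simp
    have "\<bar>gauss_avg f (c n) x - gauss_avg f (c n) 0\<bar> \<le> 2" for n x
      using abs_gauss_avg_le[OF fm f, of "c n" x] abs_gauss_avg_le[OF fm f, of "c n" 0] by linarith
    then show "AE x in N. norm (gauss_avg f (c n) x - gauss_avg f (c n) 0) \<le> 2" for n by simp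
  qed auto
  then have "(\<lambda>n. v - gauss_avg f (c n) 0) \<longlonglongrightarrow> 0"
    using i by (simp add: v N.prob_space)
  from tendsto_diff[OF tendsto_const[of v] this] show ?thesis by simp
qed

lemma emeasure_lborel_translate:
  fixes S :: "real set"
  assumes "S \<in> sets borel"
  shows "emeasure lborel {x. x + c \<in> S} = emeasure lborel S"
proof -
  have "emeasure lborel S = emeasure (distr lborel borel ((+) c)) S"
    by (simp add: lborel_distr_plus)
  also have "\<dots> = emeasure lborel {x. x + c \<in> S}"
    using assms by (subst emeasure_distr) (auto simp: vimage_def add.commute)
  finally show ?thesis ..
qed

text \<open>Reduce the shift modulo the period to some \<open>b\<close> in one period; then the piece of the set in \<open>[b, 2 pi)\<close> is
  moved down by \<open>b\<close>, and the piece in \<open>[0, b)\<close> is moved up by \<open>2 pi - b\<close>.\<close>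

lemma emeasure_periodic_translate:
  assumes P [measurable]: "P \<in> sets borel"
    and per: "\<And>x (k::int). x + 2 * pi * of_int k \<in> P \<longleftrightarrow> x \<in> P"
  shows "emeasure lborel ({0..<2*pi} \<inter> {x. x + y \<in> P}) = emeasure lborel ({0..<2*pi} \<inter> P)"
proof -
  define k where "k = \<lfloor>y / (2 * pi)\<rfloor>"
  define b where "b = y - 2 * pi * of_int k"
  have b: "0 \<le> b" "b < 2 * pi"
  proof -
    have "of_int k \<le> y / (2 * pi)" "y / (2 * pi) < of_int k + 1" unfolding k_def by linarith+
    then have "of_int k * (2 * pi) \<le> y" "y < (of_int k + 1) * (2 * pi)"
      by (simp_all add: pos_le_divide_eq pos_divide_less_eq)
    then show "0 \<le> b" "b < 2 * pi" unfolding b_def by (simp_all add: algebra_simps)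
  qed
  have yb: "x + y \<in> P \<longleftrightarrow> x + b \<in> P" for x
    using per[of "x + b" k] by (simp add: b_def algebra_simps)
  have 1: "{0..<2*pi-b} \<inter> {x. x + b \<in> P} = {x. x + b \<in> {b..<2*pi} \<inter> P}" using b by auto
  have 2: "{2*pi-b..<2*pi} \<inter> {x. x + b \<in> P} = {x. x + (b - 2*pi) \<in> {0..<b} \<inter> P}"
    using b per[of "x + b" "-1" for x] by (auto simp: algebra_simps)
  have m: "{x. x + b \<in> P} \<in> sets borel" by measurable
  have "emeasure lborel ({0..<2*pi} \<inter> {x. x + y \<in> P})
      = emeasure lborel (({0..<2*pi-b} \<inter> {x. x + b \<in> P}) \<union> ({2*pi-b..<2*pi} \<inter> {x. x + b \<in> P}))"
    using b yb by (intro arg_cong[where f="emeasure lborel"]) auto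
  also have "\<dots> = emeasure lborel ({0..<2*pi-b} \<inter> {x. x + b \<in> P}) + emeasure lborel ({2*pi-b..<2*pi} \<inter> {x. x + b \<in> P})"
    using m by (intro plus_emeasure[symmetric]) auto
  also have "\<dots> = emeasure lborel ({b..<2*pi} \<inter> P) + emeasure lborel ({0..<b} \<inter> P)"
    unfolding 1 2 by (simp only: emeasure_lborel_translate sets.Int P atLeastLessThan_borel)
  also have "\<dots> = emeasure lborel (({b..<2*pi} \<inter> P) \<union> ({0..<b} \<inter> P))"
    by (intro plus_emeasure) auto
  also have "({b..<2*pi} \<inter> P) \<union> ({0..<b} \<inter> P) = {0..<2*pi} \<inter> P" using b by auto
  finally show ?thesis .
qed

lemma gauss_avg_uniform:
  assumes A [measurable]: "A \<in> sets borel"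
  shows "(\<integral>x. gauss_avg (\<lambda>u. indicator A (to_torus u)) c x \<partial>uniform_measure lborel {0..<2*pi})
       = measure uniform_torus A"
proof -
  let ?N = "uniform_measure lborel {0..<2*pi :: real}" and ?P = "to_torus -` A"
  have e: "emeasure lborel {0..<2*pi :: real} = ennreal (2 * pi)" by simp
  interpret N: prob_space ?N
    by (rule prob_space_uniform_measure) (simp_all add: e)
  have [measurable]: "?P \<in> sets borel"
    using measurable_sets[OF measurable_to_torus A] by simp
  have per: "x + 2 * pi * of_int k \<in> ?P \<longleftrightarrow> x \<in> ?P" for x and k :: int
  proof -
    have "to_torus (x + 2 * pi * of_int k) = to_torus x" unfolding to_torus_eq_iff by auto
    then show ?thesis by simp
  qed
  have sh: "(\<integral>x. indicator A (to_torus (x + y)) \<partial>?N) = measure uniform_torus A" for y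
  proof -
    have 1: "emeasure ?N {x. x + y \<in> ?P} = emeasure ?N ?P"
      using emeasure_periodic_translate[OF _ per, of y] by (simp add: emeasure_uniform_measure)
    have "(\<integral>x. indicator A (to_torus (x + y)) \<partial>?N) = (\<integral>x. indicator {x. x + y \<in> ?P} x \<partial>?N)"
      by (intro Bochner_Integration.integral_cong) (auto simp: indicator_def)
    also have "\<dots> = measure ?N {x. x + y \<in> ?P}" by simp
    also have "\<dots> = measure ?N ?P" using 1 by (simp add: measure_def)
    also have "\<dots> = measure uniform_torus A"
      unfolding uniform_torus_def by (subst measure_distr) auto
    finally show ?thesis .
  qed
  interpret P: pair_prob_space ?N std_normal_distribution ..
  have i: "integrable (?N \<Otimes>\<^sub>M std_normal_distribution)
      (\<lambda>(x, z). indicator A (to_torus (x + c * z)) :: real)"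
    by (rule P.integrable_const_bound[where B=1]) (auto simp: indicator_def)
  have "(\<integral>x. gauss_avg (\<lambda>u. indicator A (to_torus u)) c x \<partial>?N)
      = (\<integral>z. (\<integral>x. indicator A (to_torus (x + c * z)) \<partial>?N) \<partial>std_normal_distribution)"
    unfolding gauss_avg_def by (rule P.Fubini_integral[symmetric]) (use i in simp)
  also have "\<dots> = measure uniform_torus A"
    unfolding sh using std_normal.prob_space by simp
  finally show ?thesis .
qed

context filtered_brownian begin

lemma expectation_add_increment_eq_gauss_avg:
  assumes st: "0 \<le> s" "s < t" and V: "V \<in> borel_measurable (F s)"
    and [measurable]: "f \<in> borel_measurable borel" and f: "\<And>x. \<bar>f x\<bar> \<le> 1"
  shows "expectation (\<lambda>\<omega>. f (V \<omega> + a * (B t \<omega> - B s \<omega>)))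
       = (\<integral>x. gauss_avg f (a * sqrt (t - s)) x \<partial>distr M borel V)"
proof -
  define c where "c = sqrt (t - s)"
  have c: "c > 0" using st by (simp add: c_def)
  let ?Z = "\<lambda>\<omega>. (B t \<omega> - B s \<omega>) / c"
  have Vm [measurable]: "V \<in> borel_measurable M" by (rule measurable_F[OF V st(1)])
  have [measurable]: "B t \<in> borel_measurable M" "B s \<in> borel_measurable M"
    using st by (auto intro: B_measurable)
  have d: "distr M borel ?Z = std_normal_distribution"
    using increment_std_normal[OF st] by (simp add: c_def)
  have "indep_var borel V borel ?Z"
    using indep_var_compose[OF B_increment_indep[OF st V], of "\<lambda>x. x" borel "\<lambda>x. x / c" borel]
    by (simp add: comp_def)
  then have j: "distr M borel V \<Otimes>\<^sub>M std_normal_distribution = distr M (borel \<Otimes>\<^sub>M borel) (\<lambda>\<omega>. (V \<omega>, ?Z \<omega>))"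
    unfolding indep_var_distribution_eq d by simp
  interpret V: prob_space "distr M borel V" by (rule prob_space_distr) simp
  interpret P: pair_prob_space "distr M borel V" std_normal_distribution ..
  have i: "integrable (distr M borel V \<Otimes>\<^sub>M std_normal_distribution) (\<lambda>(x, z). f (x + a * c * z))"
    by (rule P.integrable_const_bound[where B=1]) (use f in auto)
  have "(\<integral>x. gauss_avg f (a * c) x \<partial>distr M borel V)
      = (\<integral>(x, z). f (x + a * c * z) \<partial>(distr M borel V \<Otimes>\<^sub>M std_normal_distribution))"
    unfolding gauss_avg_def by (rule P.integral_fst) (use i in simp)
  also have "\<dots> = expectation (\<lambda>\<omega>. f (V \<omega> + a * c * ?Z \<omega>))"
    unfolding j by (subst integral_distr) auto
  also have "\<dots> = expectation (\<lambda>\<omega>. f (V \<omega> + a * (B t \<omega> - B s \<omega>)))"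
    using c by simp
  finally show ?thesis unfolding c_def ..
qed

text \<open>Both \<open>\<mu>\<close> and the uniform measure are unchanged by the noise at the times \<open>1, 2, 3, \<dots>\<close>, so both give any
  Borel set the limit of the same Gaussian averages.\<close>

lemma uniform_if_law_of_brownian_invariant:
  assumes X0: "X0 \<in> F 0 \<rightarrow>\<^sub>M borel" and \<sigma>: "\<sigma> > 0" and \<mu>: "\<mu> \<in> torus_prob"
    and law: "\<And>t. t > 0 \<Longrightarrow> distr M borel (\<lambda>\<omega>. X0 \<omega> + to_torus (\<sigma> * B t \<omega>)) = \<mu>"
  shows "\<mu> = uniform_torus"
proof (rule measure_eqI)
  show "sets \<mu> = sets uniform_torus"
    using \<mu> by (simp add: torus_prob_def uniform_torus_def)
  fix A assume "A \<in> sets \<mu>"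
  then have A [measurable]: "A \<in> sets borel" using \<mu> by (simp add: torus_prob_def)
  interpret \<mu>: prob_space \<mu> using \<mu> by (simp add: torus_prob_def)
  interpret U: prob_space uniform_torus
    unfolding uniform_torus_def
    by (intro prob_space.prob_space_distr prob_space_uniform_measure) auto
  let ?f = "\<lambda>u. indicator A (to_torus u) :: real"
  \<comment> \<open>Keeping \<open>B 0\<close> in the starting value makes the noise exactly the increment \<open>B t - B 0\<close>; the
    Brownian motion vanishes at time \<open>0\<close> only almost surely.\<close>
  let ?V = "\<lambda>\<omega>. torus_angle (X0 \<omega>) + \<sigma> * B 0 \<omega>"
  have fm: "?f \<in> borel_measurable borel" by measurable
  have f1: "\<bar>?f x\<bar> \<le> 1" for x by (simp add: indicator_def)
  have V: "?V \<in> borel_measurable (F 0)"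
    using X0 B_measurable_F[of 0] by measurable
  have Vm: "?V \<in> borel_measurable M" by (rule measurable_F[OF V]) simp
  define c where "c n = \<sigma> * sqrt (real (Suc n))" for n
  have c: "c n > 0" for n using \<sigma> by (simp add: c_def)
  have clim: "filterlim c at_top sequentially"
    unfolding c_def by (rule filterlim_tendsto_pos_mult_at_top[OF tendsto_const \<sigma>])
      (intro filterlim_compose[OF sqrt_at_top] filterlim_compose[OF filterlim_real_sequentially] filterlim_Suc)
  have "(\<integral>x. gauss_avg ?f (c n) x \<partial>distr M borel ?V) = measure \<mu> A" for n
  proof -
    let ?t = "real (Suc n)"
    have e: "X0 \<omega> + to_torus (\<sigma> * B ?t \<omega>) = to_torus (?V \<omega> + \<sigma> * (B ?t \<omega> - B 0 \<omega>))" for \<omega>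
    proof -
      have "?V \<omega> + \<sigma> * (B ?t \<omega> - B 0 \<omega>) = torus_angle (X0 \<omega>) + \<sigma> * B ?t \<omega>"
        by (simp add: right_diff_distrib)
      then show ?thesis by (simp only: to_torus_add torus_angle_to_torus)
    qed
    have m: "(\<lambda>\<omega>. X0 \<omega> + to_torus (\<sigma> * B ?t \<omega>)) \<in> M \<rightarrow>\<^sub>M borel"
      unfolding e using Vm B_measurable[of ?t] B_measurable[of 0] by measurable
    have "(\<integral>x. gauss_avg ?f (c n) x \<partial>distr M borel ?V) = expectation (\<lambda>\<omega>. ?f (?V \<omega> + \<sigma> * (B ?t \<omega> - B 0 \<omega>)))"
      using expectation_add_increment_eq_gauss_avg[OF _ _ V fm f1, of ?t \<sigma>] by (simp add: c_def)
    also have "\<dots> = expectation (\<lambda>\<omega>. indicator A (X0 \<omega> + to_torus (\<sigma> * B ?t \<omega>)))"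
      unfolding e ..
    also have "\<dots> = (\<integral>x. indicator A x \<partial>distr M borel (\<lambda>\<omega>. X0 \<omega> + to_torus (\<sigma> * B ?t \<omega>)))"
      by (rule integral_distr[symmetric, OF m]) simp
    also have "\<dots> = measure \<mu> A" by (subst law) (simp_all add: space_torus_prob[OF \<mu>])
    finally show ?thesis .
  qed
  from gauss_avg_tendsto_if_invariant[OF fm f1 clim c prob_space_distr[OF Vm] _ this]
  have 1: "(\<lambda>n. gauss_avg ?f (c n) 0) \<longlonglongrightarrow> measure \<mu> A" by simp
  have "prob_space (uniform_measure lborel {0..<2*pi :: real})"
    by (rule prob_space_uniform_measure) auto
  from gauss_avg_tendsto_if_invariant[OF fm f1 clim c this _ gauss_avg_uniform[OF A]]
  have 2: "(\<lambda>n. gauss_avg ?f (c n) 0) \<longlonglongrightarrow> measure uniform_torus A" by simp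
  have "measure \<mu> A = measure uniform_torus A" by (rule LIMSEQ_unique[OF 1 2])
  then show "emeasure \<mu> A = emeasure uniform_torus A"
    by (simp add: \<mu>.emeasure_eq_measure U.emeasure_eq_measure)
qed

end

section \<open>Bounds for the discounted cost\<close>

abbreviation time_measure :: "real measure" where
  "time_measure \<equiv> restrict_space lborel {0..}"

lemma
  assumes "\<beta> > 0"
  shows integrable_discount: "integrable time_measure (\<lambda>t. exp (- \<beta> * t))"
    and integral_discount: "(\<integral>t. exp (- \<beta> * t) \<partial>time_measure) = 1 / \<beta>"
proof -
  have "(\<integral>\<^sup>+t. ennreal (exponential_density \<beta> t) \<partial>lborel) = 1"
    using prob_space.emeasure_space_1[OF prob_space_exponential_density[OF assms]]
    by (simp add: emeasure_density)
  then have "has_bochner_integral lborel (exponential_density \<beta>) 1"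
    using assms by (intro has_bochner_integral_nn_integral) (auto simp: erlang_density_nonneg)
  then have "has_bochner_integral lborel (\<lambda>t. exponential_density \<beta> t / \<beta>) (1 / \<beta>)"
    by (intro has_bochner_integral_divide_zero)
  moreover have "exponential_density \<beta> t / \<beta> = indicator {0..} t *\<^sub>R exp (- \<beta> * t)" for t
    using assms by (simp add: exponential_density_def mult.commute)
  ultimately have "has_bochner_integral lborel (\<lambda>t. indicator {0..} t *\<^sub>R exp (- \<beta> * t)) (1 / \<beta>)"
    by simp
  then show "integrable time_measure (\<lambda>t. exp (- \<beta> * t))"
    and "(\<integral>t. exp (- \<beta> * t) \<partial>time_measure) = 1 / \<beta>"
    by (simp_all add: integrable_restrict_space integral_restrict_space has_bochner_integral_iff)
qed

lemma ereal_integral_mono: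
  assumes "\<And>x. x \<in> space M \<Longrightarrow> f x \<le> g x"
  shows "ereal_integral M f \<le> ereal_integral M g"
  unfolding ereal_integral_def
proof (rule ereal_minus_mono)
  show "enn2ereal (\<integral>\<^sup>+x. e2ennreal (f x) \<partial>M) \<le> enn2ereal (\<integral>\<^sup>+x. e2ennreal (g x) \<partial>M)"
    using assms by (simp add: nn_integral_mono e2ennreal_mono flip: less_eq_ennreal.rep_eq)
  show "enn2ereal (\<integral>\<^sup>+x. e2ennreal (- g x) \<partial>M) \<le> enn2ereal (\<integral>\<^sup>+x. e2ennreal (- f x) \<partial>M)"
    using assms by (simp add: nn_integral_mono e2ennreal_mono flip: less_eq_ennreal.rep_eq)
qed

lemma ereal_integral_cong:
  assumes "\<And>x. x \<in> space M \<Longrightarrow> f x = g x"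
  shows "ereal_integral M f = ereal_integral M g"
  using assms by (intro antisym ereal_integral_mono) auto

lemma ereal_integral_eq_integral:
  assumes f: "integrable M f"
  shows "ereal_integral M (\<lambda>x. ereal (f x)) = ereal (\<integral>x. f x \<partial>M)"
proof -
  have fin: "(\<integral>\<^sup>+x. ennreal (f x) \<partial>M) \<noteq> \<infinity>" "(\<integral>\<^sup>+x. ennreal (- f x) \<partial>M) \<noteq> \<infinity>"
    using f by (auto simp: real_integrable_def)
  then obtain a b where ab: "(\<integral>\<^sup>+x. ennreal (f x) \<partial>M) = ennreal a" "a \<ge> 0"
      "(\<integral>\<^sup>+x. ennreal (- f x) \<partial>M) = ennreal b" "b \<ge> 0"
    by (metis ennreal_cases infinity_ennreal_def)
  show ?thesis
    unfolding ereal_integral_def real_lebesgue_integral_def[OF f]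
    using ab by (simp add: enn2ereal_ennreal)
qed

lemma ereal_integral_nonneg:
  assumes "\<And>x. x \<in> space M \<Longrightarrow> f x \<ge> 0"
  shows "ereal_integral M f = enn2ereal (\<integral>\<^sup>+x. e2ennreal (f x) \<partial>M)"
proof -
  have "(\<integral>\<^sup>+x. e2ennreal (- f x) \<partial>M) = (\<integral>\<^sup>+x. 0 \<partial>M)"
    using assms by (intro nn_integral_cong e2ennreal_neg) simp
  then show ?thesis by (simp add: ereal_integral_def zero_ennreal.rep_eq)
qed

lemma measurable_time_pair:
  assumes "f \<in> borel_measurable (borel \<Otimes>\<^sub>M M)"
  shows "f \<in> borel_measurable (time_measure \<Otimes>\<^sub>M M)"
proof -
  have t: "fst \<in> borel_measurable (time_measure \<Otimes>\<^sub>M M)"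
    by (rule measurable_compose[OF measurable_fst]) (rule measurable_restrict_space1, simp)
  have "(\<lambda>p. (fst p, snd p)) \<in> time_measure \<Otimes>\<^sub>M M \<rightarrow>\<^sub>M borel \<Otimes>\<^sub>M M"
    by (intro measurable_Pair t measurable_snd)
  from measurable_compose[OF this assms] show ?thesis by simp
qed

text \<open>Fubini for a bounded running cost: the discount makes the integrand integrable over time and
  randomness, so the extended-real integrals are ordinary ones and may be exchanged.\<close>

lemma (in prob_space)
  fixes g :: "real \<Rightarrow> 'a \<Rightarrow> real"
  assumes \<beta>: "\<beta> > 0" and gm: "(\<lambda>(t, \<omega>). g t \<omega>) \<in> borel_measurable (borel \<Otimes>\<^sub>M M)"
    and gK: "\<And>t \<omega>. t \<ge> 0 \<Longrightarrow> \<omega> \<in> space M \<Longrightarrow> \<bar>g t \<omega>\<bar> \<le> K"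
  shows integrable_discounted_expectation:
      "integrable time_measure (\<lambda>t. exp (- \<beta> * t) * expectation (g t))"
    and ereal_integral_discounted:
      "ereal_integral M (\<lambda>\<omega>. ereal_integral time_measure (\<lambda>t. ereal (exp (- \<beta> * t) * g t \<omega>)))
        = ereal (\<integral>t. exp (- \<beta> * t) * expectation (g t) \<partial>time_measure)"
proof -
  let ?h = "\<lambda>t \<omega>. exp (- \<beta> * t) * g t \<omega>"
  interpret T: sigma_finite_measure time_measure
    by (rule sigma_finite_measure_restrict_space) (auto intro: lborel.sigma_finite_measure_axioms)
  interpret P: pair_sigma_finite time_measure M ..
  have "(\<lambda>(t, \<omega>). ?h t \<omega>) \<in> borel_measurable (borel \<Otimes>\<^sub>M M)"
    using gm by measurable
  then have hm: "(\<lambda>(t, \<omega>). ?h t \<omega>) \<in> borel_measurable (time_measure \<Otimes>\<^sub>M M)"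
    by (rule measurable_time_pair)
  have hb: "\<bar>?h t \<omega>\<bar> \<le> exp (- \<beta> * t) * K" if "t \<ge> 0" "\<omega> \<in> space M" for t \<omega>
    using gK[OF that] by (simp add: abs_mult)
  have sp: "t \<in> space time_measure \<longleftrightarrow> t \<ge> 0" for t by (simp add: space_restrict_space)
  have gt: "integrable M (g t)" if "t \<ge> 0" for t
  proof (rule integrable_const_bound[where B=K])
    show "AE x in M. norm (g t x) \<le> K" using gK[OF that] by (intro AE_I2) simp
    show "g t \<in> borel_measurable M" using measurable_compose_Pair1[OF _ gm, of t] by simp
  qed
  have hi: "integrable (time_measure \<Otimes>\<^sub>M M) (\<lambda>(t, \<omega>). ?h t \<omega>)"
  proof (rule P.Fubini_integrable[OF hm])
    show "AE t in time_measure. integrable M (\<lambda>\<omega>. (\<lambda>(t, \<omega>). ?h t \<omega>) (t, \<omega>))"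
      using gt by (intro AE_I2) (simp add: sp)
    show "integrable time_measure (\<lambda>t. \<integral>\<omega>. norm ((\<lambda>(t, \<omega>). ?h t \<omega>) (t, \<omega>)) \<partial>M)"
    proof (rule Bochner_Integration.integrable_bound)
      show "integrable time_measure (\<lambda>t. exp (- \<beta> * t) * K)"
        using integrable_discount[OF \<beta>] by (rule integrable_mult_left)
      show "(\<lambda>t. \<integral>\<omega>. norm ((\<lambda>(t, \<omega>). ?h t \<omega>) (t, \<omega>)) \<partial>M) \<in> borel_measurable time_measure"
        using hm by measurable
      show "AE t in time_measure. norm (\<integral>\<omega>. norm ((\<lambda>(t, \<omega>). ?h t \<omega>) (t, \<omega>)) \<partial>M) \<le> norm (exp (- \<beta> * t) * K)"
      proof (rule AE_I2)
        fix t assume "t \<in> space time_measure"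
        then have t: "t \<ge> 0" by (simp add: sp)
        have "(\<integral>\<omega>. norm (?h t \<omega>) \<partial>M) \<le> (\<integral>\<omega>. exp (- \<beta> * t) * K \<partial>M)"
          using gt[OF t] hb[OF t] by (intro integral_mono) auto
        moreover have "0 \<le> (\<integral>\<omega>. norm (?h t \<omega>) \<partial>M)" by simp
        ultimately show "norm (\<integral>\<omega>. norm ((\<lambda>(t, \<omega>). ?h t \<omega>) (t, \<omega>)) \<partial>M) \<le> norm (exp (- \<beta> * t) * K)"
          by (simp add: prob_space)
      qed
    qed
  qed
  show "integrable time_measure (\<lambda>t. exp (- \<beta> * t) * expectation (g t))"
    using P.integrable_fst[OF hi] by simp
  have inner: "integrable time_measure (\<lambda>t. ?h t \<omega>)" if w: "\<omega> \<in> space M" for \<omega>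
  proof (rule Bochner_Integration.integrable_bound)
    show "integrable time_measure (\<lambda>t. exp (- \<beta> * t) * K)"
      using integrable_discount[OF \<beta>] by (rule integrable_mult_left)
    show "(\<lambda>t. ?h t \<omega>) \<in> borel_measurable time_measure"
      using measurable_Pair1[OF hm w] by simp
    show "AE t in time_measure. norm (?h t \<omega>) \<le> norm (exp (- \<beta> * t) * K)"
      using hb[OF _ w] by (intro AE_I2) (force simp: sp)
  qed
  have "ereal_integral M (\<lambda>\<omega>. ereal_integral time_measure (\<lambda>t. ereal (?h t \<omega>)))
      = ereal_integral M (\<lambda>\<omega>. ereal (\<integral>t. ?h t \<omega> \<partial>time_measure))"
    by (intro ereal_integral_cong ereal_integral_eq_integral inner)
  also have "\<dots> = ereal (\<integral>\<omega>. (\<integral>t. ?h t \<omega> \<partial>time_measure) \<partial>M)"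
    by (intro ereal_integral_eq_integral P.integrable_snd hi)
  also have "\<dots> = ereal (\<integral>t. (\<integral>\<omega>. ?h t \<omega> \<partial>M) \<partial>time_measure)"
    using P.Fubini_integral[OF hi] by simp
  finally show "ereal_integral M (\<lambda>\<omega>. ereal_integral time_measure (\<lambda>t. ereal (?h t \<omega>)))
      = ereal (\<integral>t. exp (- \<beta> * t) * expectation (g t) \<partial>time_measure)"
    by simp
qed

context filtered_brownian begin

text \<open>Progressive measurability only speaks of the time intervals \<open>[0, n]\<close>; freezing the process after time \<open>n\<close>
  and letting \<open>n\<close> tend to infinity yields measurability on the whole product. Negative times are mapped to
  \<open>0\<close>, as the process is constrained only for nonnegative ones.\<close>

lemma progressive_pair_measurable:
  assumes "progressively_measurable F a"
  shows "(\<lambda>(t, \<omega>). a (max 0 t) \<omega>) \<in> borel_measurable (borel \<Otimes>\<^sub>M M)"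
proof (rule borel_measurable_LIMSEQ_real)
  fix n :: nat
  let ?T = "real n"
  have a: "(\<lambda>(t, \<omega>). a t \<omega>) \<in> borel_measurable (restrict_space borel {0..?T} \<Otimes>\<^sub>M F ?T)"
    using assms unfolding progressively_measurable_def by simp
  have id: "(\<lambda>\<omega>. \<omega>) \<in> M \<rightarrow>\<^sub>M F ?T" by (rule measurable_F[where t="?T"]) auto
  have "(\<lambda>p. (max 0 (min ?T (fst p)), snd p)) \<in> borel \<Otimes>\<^sub>M M \<rightarrow>\<^sub>M restrict_space borel {0..?T} \<Otimes>\<^sub>M F ?T"
    by (intro measurable_Pair measurable_restrict_space2 measurable_compose[OF measurable_snd id]) auto
  from measurable_compose[OF this a]
  show "(\<lambda>(t, \<omega>). a (max 0 (min ?T t)) \<omega>) \<in> borel_measurable (borel \<Otimes>\<^sub>M M)"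
    by (simp add: split_beta')
next
  fix p :: "real \<times> 'w"
  obtain t \<omega> where p: "p = (t, \<omega>)" by (cases p)
  obtain N where N: "t \<le> real N" using real_arch_simple by blast
  have "(\<lambda>n. a (max 0 (min (real n) t)) \<omega>) \<longlonglongrightarrow> a (max 0 t) \<omega>"
  proof (rule tendsto_eventually)
    have "max 0 (min (real n) t) = max 0 t" if "n \<ge> N" for n
      using that N by (simp add: min_absorb2 order_trans[OF N])
    then show "\<forall>\<^sub>F n in sequentially. a (max 0 (min (real n) t)) \<omega> = a (max 0 t) \<omega>"
      unfolding eventually_sequentially by (intro exI[of _ N]) simp
  qed
  then show "(\<lambda>n. (\<lambda>(t, \<omega>). a (max 0 (min (real n) t)) \<omega>) p) \<longlonglongrightarrow> (\<lambda>(t, \<omega>). a (max 0 t) \<omega>) p"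
    by (simp add: p)
qed

lemma drift_pair_measurable:
  assumes "progressively_measurable F a"
  shows "(\<lambda>(t, \<omega>). LBINT u:{0..t}. a u \<omega>) \<in> borel_measurable (borel \<Otimes>\<^sub>M M)"
proof -
  note [measurable] = progressive_pair_measurable[OF assms]
  have e: "(LBINT u:{0..t}. a u \<omega>) = (\<integral>u. (if 0 \<le> u \<and> u \<le> t then a (max 0 u) \<omega> else 0) \<partial>lborel)" for t \<omega>
    unfolding set_lebesgue_integral_def
    by (intro Bochner_Integration.integral_cong) (auto simp: indicator_def)
  show ?thesis unfolding e by measurable
qed

text \<open>The state on the universal cover, where drift and noise are simply added. The maximum with \<open>0\<close> makes it
  jointly measurable for all real times.\<close>

definition lifted_state ::
  "real \<Rightarrow> ('w \<Rightarrow> torus) \<Rightarrow> (real \<Rightarrow> 'w \<Rightarrow> real) \<Rightarrow> real \<Rightarrow> 'w \<Rightarrow> real" where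
  "lifted_state \<sigma> X0 a t \<omega> =
     torus_angle (X0 \<omega>) + (LBINT u:{0..t}. a u \<omega>) + \<sigma> * B (max 0 t) \<omega>"

lemma state_eq_lifted:
  "t \<ge> 0 \<Longrightarrow> state \<sigma> B X0 a t \<omega> = to_torus (lifted_state \<sigma> X0 a t \<omega>)"
  unfolding state_def lifted_state_def
  by (simp only: to_torus_add torus_angle_to_torus max_absorb2 add.assoc)

lemma lifted_state_pair_measurable:
  assumes "progressively_measurable F a" and X0: "X0 \<in> F 0 \<rightarrow>\<^sub>M borel"
  shows "(\<lambda>(t, \<omega>). lifted_state \<sigma> X0 a t \<omega>) \<in> borel_measurable (borel \<Otimes>\<^sub>M M)"
proof -
  have X0m [measurable]: "X0 \<in> M \<rightarrow>\<^sub>M borel" by (rule measurable_F[OF X0]) simp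
  note [measurable] = drift_pair_measurable[OF assms(1)] B_pair_measurable
  show ?thesis unfolding lifted_state_def by measurable
qed

lemma lifted_state_measurable:
  assumes "progressively_measurable F a" and X0: "X0 \<in> F 0 \<rightarrow>\<^sub>M borel"
  shows "lifted_state \<sigma> X0 a t \<in> borel_measurable M"
  using measurable_compose_Pair1[OF _ lifted_state_pair_measurable[OF assms], of t] by simp

end

lemma running_cost_polar:
  assumes "(\<integral>x. cos_torus x \<partial>\<mu>) = r * cos \<phi>" "(\<integral>x. sin_torus x \<partial>\<mu>) = r * sin \<phi>"
  shows "running_cost \<kappa> (\<lambda>_. \<mu>) t (to_torus y) = - (\<kappa> * r) * cos (y - \<phi>)"
  unfolding running_cost_def assms by (simp add: cos_diff algebra_simps)

context filtered_brownian begin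

lemma cost_polar:
  assumes "(\<integral>x. cos_torus x \<partial>\<mu>) = r * cos \<phi>" "(\<integral>x. sin_torus x \<partial>\<mu>) = r * sin \<phi>"
  shows "cost \<beta> \<sigma> M B \<kappa> (\<lambda>_. \<mu>) X0 a =
    ereal_integral M (\<lambda>\<omega>. ereal_integral time_measure (\<lambda>t.
      ereal (exp (- \<beta> * t) *
        (- (\<kappa> * r) * cos (lifted_state \<sigma> X0 a t \<omega> - \<phi>) + (a (max 0 t) \<omega>)\<^sup>2 / 2))))"
  unfolding cost_def
  by (intro ereal_integral_cong) (simp add: space_restrict_space state_eq_lifted running_cost_polar[OF assms])

text \<open>The form of the bound on the expected running cost, a constant plus a correction on one bounded time
  interval, fits both test controls: there the correction is the gain during one unit of time or the
  price of the initial period.\<close>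

lemma cost_le_of_bounded_control:
  assumes \<beta>: "\<beta> > 0"
    and polar: "(\<integral>x. cos_torus x \<partial>\<mu>) = r * cos \<phi>" "(\<integral>x. sin_torus x \<partial>\<mu>) = r * sin \<phi>"
    and a: "progressively_measurable F a" and X0: "X0 \<in> F 0 \<rightarrow>\<^sub>M borel"
    and K: "\<And>t \<omega>. t \<ge> 0 \<Longrightarrow> \<omega> \<in> space M \<Longrightarrow> \<bar>a t \<omega>\<bar> \<le> K"
    and pq: "0 \<le> p" "p \<le> q"
    and bound: "\<And>t. t \<ge> 0 \<Longrightarrow>
      exp (- \<beta> * t) * expectation (\<lambda>\<omega>. - (\<kappa> * r) * cos (lifted_state \<sigma> X0 a t \<omega> - \<phi>) + (a t \<omega>)\<^sup>2 / 2)
        \<le> c * exp (- \<beta> * t) + d * indicator {p..<q} t"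
  shows "cost \<beta> \<sigma> M B \<kappa> (\<lambda>_. \<mu>) X0 a \<le> ereal (c / \<beta> + d * (q - p))"
proof -
  let ?g = "\<lambda>t \<omega>. - (\<kappa> * r) * cos (lifted_state \<sigma> X0 a t \<omega> - \<phi>) + (a (max 0 t) \<omega>)\<^sup>2 / 2"
  have gm: "(\<lambda>(t, \<omega>). ?g t \<omega>) \<in> borel_measurable (borel \<Otimes>\<^sub>M M)"
    using lifted_state_pair_measurable[OF a X0, of \<sigma>] progressive_pair_measurable[OF a] by measurable
  have gK: "\<bar>?g t \<omega>\<bar> \<le> \<bar>\<kappa> * r\<bar> + K\<^sup>2 / 2" if "t \<ge> 0" "\<omega> \<in> space M" for t \<omega>
  proof -
    have "\<bar>- (\<kappa> * r) * cos (lifted_state \<sigma> X0 a t \<omega> - \<phi>)\<bar> \<le> \<bar>\<kappa> * r\<bar>"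
      unfolding abs_mult abs_minus_cancel by (intro mult_left_le) auto
    moreover have "(a t \<omega>)\<^sup>2 \<le> K\<^sup>2"
      using K[OF that] by (intro abs_le_square_iff[THEN iffD1]) simp
    moreover have "\<bar>(a t \<omega>)\<^sup>2 / 2\<bar> = (a t \<omega>)\<^sup>2 / 2" by simp
    ultimately show ?thesis
      unfolding max_absorb2[OF that(1)]
      by (intro order_trans[OF abs_triangle_ineq]) linarith
  qed
  have ii: "has_bochner_integral time_measure (indicator {p..<q}) (q - p)"
  proof -
    have e: "indicator {0..} t *\<^sub>R indicator {p..<q} t = (indicator {p..<q} t :: real)" for t
      using pq by (auto simp: indicator_def)
    have S: "{0::real..} \<inter> space lborel \<in> sets lborel" by simp
    show ?thesis
      unfolding has_bochner_integral_iff integrable_restrict_space[OF S] integral_restrict_space[OF S] e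
      using pq by simp
  qed
  then have ii': "integrable time_measure (indicator {p..<q} :: real \<Rightarrow> real)"
      "(\<integral>t. indicator {p..<q} t \<partial>time_measure) = q - p"
    by (simp_all add: has_bochner_integral_iff)
  have eq: "cost \<beta> \<sigma> M B \<kappa> (\<lambda>_. \<mu>) X0 a = ereal (\<integral>t. exp (- \<beta> * t) * expectation (?g t) \<partial>time_measure)"
    unfolding cost_polar[OF polar] by (rule ereal_integral_discounted[OF \<beta> gm gK])
  have "(\<integral>t. exp (- \<beta> * t) * expectation (?g t) \<partial>time_measure)
      \<le> (\<integral>t. c * exp (- \<beta> * t) + d * indicator {p..<q} t \<partial>time_measure)"
  proof (rule integral_mono)
    show "integrable time_measure (\<lambda>t. exp (- \<beta> * t) * expectation (?g t))"
      by (rule integrable_discounted_expectation[OF \<beta> gm gK])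
    show "integrable time_measure (\<lambda>t. c * exp (- \<beta> * t) + d * indicator {p..<q} t)"
      using integrable_discount[OF \<beta>] ii' by auto
    fix t assume "t \<in> space time_measure"
    then have "t \<ge> 0" by (simp add: space_restrict_space)
    then show "exp (- \<beta> * t) * expectation (?g t) \<le> c * exp (- \<beta> * t) + d * indicator {p..<q} t"
      using bound[of t] by simp
  qed
  also have "\<dots> = c / \<beta> + d * (q - p)"
    using Bochner_Integration.integral_add[OF integrable_mult_right[OF integrable_discount[OF \<beta>], of c]
        integrable_mult_right[OF ii'(1), of d]]
    unfolding integral_mult_right_zero ii'(2) integral_discount[OF \<beta>] by (simp only: mult_1_right times_divide_eq_right)
  finally show ?thesis unfolding eq by (simp only: ereal_less_eq)
qed

text \<open>The energy \<open>\<alpha>\<^sup>2 / 2\<close> is nonnegative, and by stationarity the remaining running cost has expectation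
  \<open>- \<kappa> r * r\<close> at every time.\<close>

lemma cost_ge_of_stationary:
  assumes \<beta>: "\<beta> > 0"
    and polar: "(\<integral>x. cos_torus x \<partial>\<mu>) = r * cos \<phi>" "(\<integral>x. sin_torus x \<partial>\<mu>) = r * sin \<phi>"
    and \<mu>: "\<mu> \<in> torus_prob"
    and a: "progressively_measurable F a" and X0: "X0 \<in> F 0 \<rightarrow>\<^sub>M borel"
    and law: "\<And>t. t \<ge> 0 \<Longrightarrow> distr M borel (state \<sigma> B X0 a t) = \<mu>"
  shows "ereal (- (\<kappa> * r) * r / \<beta>) \<le> cost \<beta> \<sigma> M B \<kappa> (\<lambda>_. \<mu>) X0 a"
proof -
  let ?g = "\<lambda>t \<omega>. - (\<kappa> * r) * cos (lifted_state \<sigma> X0 a t \<omega> - \<phi>)"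
  have gm: "(\<lambda>(t, \<omega>). ?g t \<omega>) \<in> borel_measurable (borel \<Otimes>\<^sub>M M)"
    using lifted_state_pair_measurable[OF a X0, of \<sigma>] by measurable
  have gK: "\<bar>?g t \<omega>\<bar> \<le> \<bar>\<kappa> * r\<bar>" for t \<omega>
    unfolding abs_mult abs_minus_cancel by (intro mult_left_le) auto
  have E: "expectation (?g t) = - (\<kappa> * r) * r" if t: "t \<ge> 0" for t
  proof -
    have m: "state \<sigma> B X0 a t \<in> M \<rightarrow>\<^sub>M borel"
      unfolding state_eq_lifted[OF t] by (intro measurable_compose[OF lifted_state_measurable[OF a X0]]) simp
    have "expectation (\<lambda>\<omega>. cos (lifted_state \<sigma> X0 a t \<omega> - \<phi>))
        = expectation (\<lambda>\<omega>. cos_torus (state \<sigma> B X0 a t \<omega>) * cos \<phi> + sin_torus (state \<sigma> B X0 a t \<omega>) * sin \<phi>)"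
      by (simp add: state_eq_lifted[OF t] cos_diff)
    also have "\<dots> = (\<integral>x. cos_torus x * cos \<phi> + sin_torus x * sin \<phi> \<partial>distr M borel (state \<sigma> B X0 a t))"
      by (rule integral_distr[symmetric, OF m]) simp
    also have "\<dots> = (\<integral>x. cos_torus x * cos \<phi> + sin_torus x * sin \<phi> \<partial>\<mu>)"
      unfolding law[OF t] ..
    also have "\<dots> = r" by (rule integral_rotated_cos_torus[OF \<mu> polar])
    finally show ?thesis by simp
  qed
  have "ereal (- (\<kappa> * r) * r / \<beta>) = ereal (\<integral>t. exp (- \<beta> * t) * expectation (?g t) \<partial>time_measure)"
  proof -
    have "(\<integral>t. exp (- \<beta> * t) * expectation (?g t) \<partial>time_measure)
        = (\<integral>t. exp (- \<beta> * t) * (- (\<kappa> * r) * r) \<partial>time_measure)"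
      by (intro Bochner_Integration.integral_cong refl) (use E in \<open>simp add: space_restrict_space\<close>)
    also have "\<dots> = (1 / \<beta>) * (- (\<kappa> * r) * r)"
      unfolding integral_mult_left_zero integral_discount[OF \<beta>] ..
    finally show ?thesis by simp
  qed
  also have "\<dots> = ereal_integral M (\<lambda>\<omega>. ereal_integral time_measure (\<lambda>t. ereal (exp (- \<beta> * t) * ?g t \<omega>)))"
    by (rule ereal_integral_discounted[symmetric, OF \<beta> gm gK])
  also have "\<dots> \<le> cost \<beta> \<sigma> M B \<kappa> (\<lambda>_. \<mu>) X0 a"
    unfolding cost_polar[OF polar]
    by (intro ereal_integral_mono ereal_less_eq(3)[THEN iffD2] mult_left_mono) auto
  finally show ?thesis .
qed

text \<open>Without interaction term the cost is the discounted energy, so a nonpositive cost forces the control to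
  vanish for almost every time and path.\<close>

lemma zero_cost_control_has_no_drift:
  assumes polar: "(\<integral>x. cos_torus x \<partial>\<mu>) = 0" "(\<integral>x. sin_torus x \<partial>\<mu>) = 0"
    and a: "progressively_measurable F a"
    and c: "cost \<beta> \<sigma> M B \<kappa> (\<lambda>_. \<mu>) X0 a \<le> 0"
  shows "AE \<omega> in M. \<forall>t. (LBINT u:{0..t}. a u \<omega>) = 0"
proof -
  interpret T: sigma_finite_measure time_measure
    by (rule sigma_finite_measure_restrict_space) (auto intro: lborel.sigma_finite_measure_axioms)
  let ?h = "\<lambda>t \<omega>. exp (- \<beta> * t) * ((a (max 0 t) \<omega>)\<^sup>2 / 2)"
  have "(\<lambda>(t, \<omega>). ?h t \<omega>) \<in> borel_measurable (borel \<Otimes>\<^sub>M M)"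
    using progressive_pair_measurable[OF a] by measurable
  then have hm [measurable]: "(\<lambda>(t, \<omega>). ?h t \<omega>) \<in> borel_measurable (time_measure \<Otimes>\<^sub>M M)"
    by (rule measurable_time_pair)
  have hm': "(\<lambda>\<omega>. \<integral>\<^sup>+t. ennreal (?h t \<omega>) \<partial>time_measure) \<in> borel_measurable M"
    by measurable
  have "cost \<beta> \<sigma> M B \<kappa> (\<lambda>_. \<mu>) X0 a
      = ereal_integral M (\<lambda>\<omega>. ereal_integral time_measure (\<lambda>t. ereal (?h t \<omega>)))"
    using cost_polar[of \<mu> 0 0 \<beta> \<sigma> \<kappa> X0 a] polar by simp
  also have "\<dots> = ereal_integral M (\<lambda>\<omega>. enn2ereal (\<integral>\<^sup>+t. ennreal (?h t \<omega>) \<partial>time_measure))"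
    by (subst ereal_integral_nonneg[where M=time_measure]) simp_all
  also have "\<dots> = enn2ereal (\<integral>\<^sup>+\<omega>. (\<integral>\<^sup>+t. ennreal (?h t \<omega>) \<partial>time_measure) \<partial>M)"
    by (subst ereal_integral_nonneg) simp_all
  finally have "enn2ereal (\<integral>\<^sup>+\<omega>. (\<integral>\<^sup>+t. ennreal (?h t \<omega>) \<partial>time_measure) \<partial>M) \<le> 0"
    using c by simp
  then have "(\<integral>\<^sup>+\<omega>. (\<integral>\<^sup>+t. ennreal (?h t \<omega>) \<partial>time_measure) \<partial>M) \<le> 0"
    by (simp add: less_eq_ennreal.rep_eq zero_ennreal.rep_eq)
  then have "AE \<omega> in M. (\<integral>\<^sup>+t. ennreal (?h t \<omega>) \<partial>time_measure) = 0"
    by (subst nn_integral_0_iff_AE[OF hm', symmetric]) simp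
  with AE_space[of M] show ?thesis
  proof (eventually_elim, intro allI)
    case (elim \<omega>)
    fix t
    show "(LBINT u:{0..t}. a u \<omega>) = 0"
    proof -
      have "(\<lambda>t. ennreal (?h t \<omega>)) \<in> borel_measurable time_measure"
        using measurable_Pair1[OF hm elim(1)] by simp
      then have "AE t in time_measure. ennreal (?h t \<omega>) = 0"
        using elim(2) by (simp add: nn_integral_0_iff_AE)
      then have "AE t in lborel. t \<in> {0..} \<longrightarrow> ennreal (?h t \<omega>) = 0"
        by (subst (asm) AE_restrict_space_iff) auto
      then have "AE u in lborel. indicator {0..t} u *\<^sub>R a u \<omega> = 0"
        by eventually_elim (auto simp: indicator_def ennreal_eq_0_iff mult_le_0_iff zero_le_mult_iff not_le)
      then show ?thesis
        unfolding set_lebesgue_integral_def by (rule integral_eq_zero_AE)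
    qed
  qed
qed

end

section \<open>Piecewise constant controls\<close>

text \<open>The representative in \<open>[- pi, pi]\<close> is the shortest one.\<close>

lemma torus_angle_to_torus_square_le: "(torus_angle (to_torus z))\<^sup>2 \<le> z\<^sup>2"
proof -
  let ?w = "torus_angle (to_torus z)"
  have "\<bar>?w\<bar> \<le> \<bar>z\<bar>"
  proof (cases "\<bar>z\<bar> \<le> pi")
    case True
    have "cos ?w = cos z"
      using torus_angle_to_torus[of "to_torus z"] unfolding to_torus_eq_iff_sin_cos by simp
    then have "cos \<bar>?w\<bar> = cos \<bar>z\<bar>" by simp
    from cos_inj_pi[OF abs_ge_zero abs_torus_angle_le abs_ge_zero True this]
    have "\<bar>?w\<bar> = \<bar>z\<bar>" .
    then show ?thesis by simp
  next
    case False
    then show ?thesis using abs_torus_angle_le[of "to_torus z"] by linarith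
  qed
  then show ?thesis by (rule abs_le_square_iff[THEN iffD1])
qed

lemma cos_eq_if_to_torus_eq: "to_torus x = to_torus y \<Longrightarrow> cos x = cos y"
  unfolding to_torus_eq_iff_sin_cos by simp

definition step_control :: "real \<Rightarrow> (nat \<Rightarrow> 'w \<Rightarrow> real) \<Rightarrow> real \<Rightarrow> 'w \<Rightarrow> real" where
  "step_control h G t \<omega> = G (nat \<lfloor>t / h\<rfloor>) \<omega>"

lemma nat_floor_divide_bounds:
  fixes t h :: real
  assumes "h > 0" "t \<ge> 0"
  shows "real (nat \<lfloor>t / h\<rfloor>) * h \<le> t" "t < (real (nat \<lfloor>t / h\<rfloor>) + 1) * h"
proof -
  have "t / h \<ge> 0" using assms by simp
  then have "real (nat \<lfloor>t / h\<rfloor>) \<le> t / h" "t / h < real (nat \<lfloor>t / h\<rfloor>) + 1" by linarith+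
  then show "real (nat \<lfloor>t / h\<rfloor>) * h \<le> t" "t < (real (nat \<lfloor>t / h\<rfloor>) + 1) * h"
    unfolding pos_le_divide_eq[OF assms(1)] pos_divide_less_eq[OF assms(1)] .
qed

lemma nat_floor_divide_eq:
  fixes t h :: real
  assumes "h > 0" "real j * h \<le> t" "t < (real j + 1) * h"
  shows "nat \<lfloor>t / h\<rfloor> = j"
proof -
  have "real j \<le> t / h" "t / h < real j + 1"
    using assms by (simp_all add: pos_le_divide_eq pos_divide_less_eq)
  then have "\<lfloor>t / h\<rfloor> = int j" by (simp add: floor_eq_iff)
  then show ?thesis by simp
qed

text \<open>On \<open>[0, t]\<close> the control is a sum of multiples of indicators of the grid intervals, the last one being cut off at
  \<open>t\<close>.\<close>

lemma step_control_drift: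
  assumes h: "h > 0" and t: "real j * h \<le> t" "t < (real j + 1) * h"
  shows "(LBINT u:{0..t}. step_control h G u \<omega>) = h * (\<Sum>i<j. G i \<omega>) + (t - real j * h) * G j \<omega>"
proof -
  have e: "indicator {0..t} u *\<^sub>R step_control h G u \<omega>
      = (\<Sum>i<j. indicator {real i * h..<(real i + 1) * h} u *\<^sub>R G i \<omega>) + indicator {real j * h..t} u *\<^sub>R G j \<omega>"
    (is "?l = ?r") for u
  proof (cases "u \<in> {0..t}")
    case False
    have upper: "(real i + 1) * h \<le> t" if "i < j" for i
    proof -
      have "(real i + 1) * h \<le> real j * h" using that h by (intro mult_right_mono) auto
      then show ?thesis using t by linarith
    qed
    have lower: "0 \<le> real i * h" for i using h by simp
    have "u \<notin> {real i * h..<(real i + 1) * h}" if "i < j" for i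
      using False upper[OF that] lower[of i] by auto
    moreover have "u \<notin> {real j * h..t}"
      using False lower[of j] by auto
    ultimately have "?r = 0" by simp
    then show ?thesis using False by simp
  next
    case True
    define k where "k = nat \<lfloor>u / h\<rfloor>"
    have k: "real k * h \<le> u" "u < (real k + 1) * h"
      using nat_floor_divide_bounds[OF h, of u] True by (auto simp: k_def)
    have un: "u \<in> {real i * h..<(real i + 1) * h} \<longleftrightarrow> i = k" for i
      using nat_floor_divide_eq[OF h, of i u] k by (auto simp: k_def)
    have s: "(\<Sum>i<j. indicator {real i * h..<(real i + 1) * h} u *\<^sub>R G i \<omega>) = (if k < j then G k \<omega> else 0)"
    proof -
      have "(\<Sum>i<j. indicator {real i * h..<(real i + 1) * h} u *\<^sub>R G i \<omega>) = (\<Sum>i<j. if i = k then G k \<omega> else 0)"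
        by (intro sum.cong refl) (auto simp: indicator_def un simp del: atLeastLessThan_iff)
      then show ?thesis by simp
    qed
    have "real k * h < (real j + 1) * h" using k t True by auto
    then have kj: "k \<le> j" using h by simp
    have l: "u \<in> {real j * h..t} \<longleftrightarrow> k = j"
    proof
      assume "u \<in> {real j * h..t}"
      then have "u \<in> {real j * h..<(real j + 1) * h}" using t by auto
      from iffD1[OF un this] show "k = j" ..
    next
      assume "k = j" then show "u \<in> {real j * h..t}" using k True by auto
    qed
    show ?thesis
      unfolding s using True kj l by (auto simp: indicator_def step_control_def k_def[symmetric])
  qed
  have f: "emeasure lborel {real j * h..t} < \<infinity>" "emeasure lborel {real i * h..<(real i + 1) * h} < \<infinity>" for i
    using t h by (simp_all add: emeasure_lborel_Icc_eq mult_right_mono)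
  have i1: "integrable lborel (\<lambda>u. indicator {real i * h..<(real i + 1) * h} u *\<^sub>R G i \<omega>)" for i
    using f by (intro integrable_scaleR_left integrable_real_indicator) auto
  have i2: "integrable lborel (\<lambda>u. indicator {real j * h..t} u *\<^sub>R G j \<omega>)"
    using f by (intro integrable_scaleR_left integrable_real_indicator) auto
  have "(LBINT u:{0..t}. step_control h G u \<omega>)
      = (\<integral>u. (\<Sum>i<j. indicator {real i * h..<(real i + 1) * h} u *\<^sub>R G i \<omega>) + indicator {real j * h..t} u *\<^sub>R G j \<omega> \<partial>lborel)"
    unfolding set_lebesgue_integral_def e ..
  also have "\<dots> = (\<Sum>i<j. \<integral>u. indicator {real i * h..<(real i + 1) * h} u *\<^sub>R G i \<omega> \<partial>lborel)
      + (\<integral>u. indicator {real j * h..t} u *\<^sub>R G j \<omega> \<partial>lborel)"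
    by (simp only: Bochner_Integration.integral_add[OF Bochner_Integration.integrable_sum[OF i1] i2]
        Bochner_Integration.integral_sum[OF i1])
  also have "(\<integral>u. indicator {real j * h..t} u *\<^sub>R G j \<omega> \<partial>lborel) = (t - real j * h) * G j \<omega>"
    using t by simp
  also have "(\<Sum>i<j. \<integral>u. indicator {real i * h..<(real i + 1) * h} u *\<^sub>R G i \<omega> \<partial>lborel) = h * (\<Sum>i<j. G i \<omega>)"
    using h unfolding sum_distrib_left by (intro sum.cong) (simp_all add: algebra_simps)
  finally show ?thesis .
qed

context filtered_brownian begin

text \<open>The value used from time \<open>j h\<close> on is known at that time. Up to time \<open>T\<close> only finitely many of these values
  occur, and all of them are known at time \<open>T\<close>; the others are replaced by \<open>0\<close>.\<close>

lemma step_control_progressive: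
  assumes h: "h > 0" and G: "\<And>j. G j \<in> borel_measurable (F (real j * h))"
  shows "progressively_measurable F (step_control h G)"
  unfolding progressively_measurable_def
proof (intro allI impI)
  fix T :: real assume T: "0 \<le> T"
  let ?R = "restrict_space borel {0..T} \<Otimes>\<^sub>M F T"
  define G' where "G' j = (if real j * h \<le> T then G j else (\<lambda>_. 0))" for j
  have G': "G' j \<in> borel_measurable (F T)" for j
    unfolding G'_def using measurable_F_mono[OF G, of j T] h by auto
  have fst: "fst \<in> borel_measurable ?R"
    by (rule measurable_compose[OF measurable_fst]) (rule measurable_restrict_space1, simp)
  have "(\<lambda>p. G' (nat \<lfloor>fst p / h\<rfloor>) (snd p)) \<in> borel_measurable ?R"
  proof (rule measurable_compose_countable[where g="\<lambda>p. nat \<lfloor>fst p / h\<rfloor>" and f="\<lambda>j p. G' j (snd p)"])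
    show "(\<lambda>p. G' j (snd p)) \<in> borel_measurable ?R" for j
      by (rule measurable_compose[OF measurable_snd G'])
    show "(\<lambda>p. nat \<lfloor>fst p / h\<rfloor>) \<in> ?R \<rightarrow>\<^sub>M count_space UNIV"
      using fst by measurable
  qed
  moreover have "(\<lambda>(t, \<omega>). step_control h G t \<omega>) p = G' (nat \<lfloor>fst p / h\<rfloor>) (snd p)" if "p \<in> space ?R" for p
  proof -
    have "0 \<le> fst p" "fst p \<le> T" using that by (auto simp: space_pair_measure space_restrict_space)
    then have "real (nat \<lfloor>fst p / h\<rfloor>) * h \<le> T"
      using nat_floor_divide_bounds(1)[OF h, of "fst p"] by linarith
    then show ?thesis by (simp add: split_beta' step_control_def G'_def)
  qed
  ultimately show "(\<lambda>(t, \<omega>). step_control h G t \<omega>) \<in> borel_measurable ?R"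
    by (subst measurable_cong) auto
qed

lemma expectation_cos_initial:
  assumes X0: "X0 \<in> F 0 \<rightarrow>\<^sub>M borel" and law: "distr M borel X0 = \<mu>" and \<mu>: "\<mu> \<in> torus_prob"
    and polar: "(\<integral>x. cos_torus x \<partial>\<mu>) = r * cos \<phi>" "(\<integral>x. sin_torus x \<partial>\<mu>) = r * sin \<phi>"
  shows "expectation (\<lambda>\<omega>. cos (torus_angle (X0 \<omega>) - \<phi> + \<sigma> * B 0 \<omega>)) = r"
proof -
  have X0m [measurable]: "X0 \<in> M \<rightarrow>\<^sub>M borel" by (rule measurable_F[OF X0]) simp
  have [measurable]: "B 0 \<in> borel_measurable M" by (rule B_measurable) simp
  have ca: "cos (torus_angle x) = cos_torus x" and sa: "sin (torus_angle x) = sin_torus x" for x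
    by (metis cos_torus_to_torus sin_torus_to_torus torus_angle_to_torus)+
  have "expectation (\<lambda>\<omega>. cos (torus_angle (X0 \<omega>) - \<phi> + \<sigma> * B 0 \<omega>))
      = expectation (\<lambda>\<omega>. cos_torus (X0 \<omega>) * cos \<phi> + sin_torus (X0 \<omega>) * sin \<phi>)"
  proof (rule integral_cong_AE)
    show "AE \<omega> in M. cos (torus_angle (X0 \<omega>) - \<phi> + \<sigma> * B 0 \<omega>)
        = cos_torus (X0 \<omega>) * cos \<phi> + sin_torus (X0 \<omega>) * sin \<phi>"
      using B_0 by eventually_elim (simp add: cos_diff ca sa)
  qed measurable
  also have "\<dots> = (\<integral>x. cos_torus x * cos \<phi> + sin_torus x * sin \<phi> \<partial>distr M borel X0)"
    by (rule integral_distr[symmetric, OF X0m]) simp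
  also have "\<dots> = (\<integral>x. cos_torus x * cos \<phi> + sin_torus x * sin \<phi> \<partial>\<mu>)"
    unfolding law ..
  also have "\<dots> = r" by (rule integral_rotated_cos_torus[OF \<mu> polar])
  finally show ?thesis .
qed

end

section \<open>A small push: the effective coupling is large\<close>

lemma one_minus_cos_le: "1 - cos y \<le> y\<^sup>2 / 2" for y :: real
proof -
  have "1 - cos y = 2 * (sin (y / 2))\<^sup>2" using cos_double_sin[of "y / 2"] by simp
  also have "\<dots> \<le> 2 * (y / 2)\<^sup>2"
    using abs_sin_x_le_abs_x[of "y / 2"] by (simp only: abs_le_square_iff)
  finally show ?thesis by (simp add: power2_eq_square)
qed

text \<open>Taylor expansion of second order in the displacement \<open>a\<close>; the \<open>m\<close>-th derivative of the cosine is the cosine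
  advanced by \<open>m\<close> quarter turns.\<close>

lemma cos_add_ge_Taylor: "cos x - a * sin x - a\<^sup>2 / 2 \<le> cos (x + a)" for x a :: real
proof -
  let ?d = "\<lambda>(m::nat) b. cos (x + b + real m * pi / 2)"
  have "\<forall>m b. DERIV (?d m) b :> ?d (Suc m) b"
  proof (intro allI)
    fix m :: nat and b :: real
    have "?d (Suc m) b = - sin (x + b + real m * pi / 2)"
    proof -
      have "x + b + real (Suc m) * pi / 2 = (x + b + real m * pi / 2) + pi / 2"
        by (simp add: field_simps)
      then show ?thesis by (simp only: cos_add) simp
    qed
    moreover have "DERIV (?d m) b :> - sin (x + b + real m * pi / 2)"
      by (auto intro!: derivative_eq_intros)
    ultimately show "DERIV (?d m) b :> ?d (Suc m) b" by simp
  qed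
  from Maclaurin_all_le[OF refl this, of a 2] obtain t where
    t: "?d 0 a = (\<Sum>m<2. ?d m 0 / fact m * a ^ m) + ?d 2 t / fact 2 * a ^ 2" by blast
  have "?d 1 0 = - sin x" by (simp add: cos_add)
  then have "(\<Sum>m<2. ?d m 0 / fact m * a ^ m) = cos x - a * sin x"
    by (simp add: numeral_2_eq_2)
  moreover have "- 1 / 2 * a\<^sup>2 \<le> ?d 2 t / 2 * a\<^sup>2"
    using cos_ge_minus_one[of "x + t + real 2 * pi / 2"] by (intro mult_right_mono) auto
  ultimately show ?thesis using t by simp
qed

context filtered_brownian begin

lemma expectation_le_bounded_integrable:
  fixes f g :: "'w \<Rightarrow> real"
  assumes "f \<in> borel_measurable M" "\<And>\<omega>. \<omega> \<in> space M \<Longrightarrow> \<bar>f \<omega>\<bar> \<le> K"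
    and "integrable M g" "\<And>\<omega>. \<omega> \<in> space M \<Longrightarrow> f \<omega> \<le> g \<omega>"
  shows "expectation f \<le> expectation g"
proof (rule integral_mono)
  show "integrable M f" using assms(1,2) by (intro integrable_const_bound[where B=K]) auto
qed (use assms in auto)

text \<open>Let \<open>W\<close> be the displacement from \<open>\<phi>\<close> at time \<open>1\<close> of the uncontrolled process, and push with \<open>- \<eta> sin W\<close> during
  \<open>[1, 2)\<close>. To first order in \<open>\<eta>\<close> the running cost at a time \<open>t \<ge> 1\<close> changes by
  \<open>- \<theta> \<eta> \<tau> E (sin W sin U)\<close>, where \<open>U\<close> is the uncontrolled displacement at time \<open>t\<close> and \<open>\<tau>\<close> is the
  duration of the push so far. This expectation is a damped multiple of \<open>E (sin W)\<^sup>2\<close>, and the latter is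
  bounded below independently of \<open>\<mu>\<close>, because one unit of noise prevents \<open>cos (2 W)\<close> from
  having mean close to \<open>1\<close>; waiting until time \<open>1\<close> serves this purpose. The uncontrolled cost itself is
  nonpositive, since the noise only damps the initial mean \<open>r \<ge> 0\<close> of the cosine. Only the gain during
  \<open>[2, 3)\<close> is kept, which is where the factors \<open>exp (- \<sigma>\<^sup>2)\<close> and \<open>exp (- 3 \<beta>)\<close> come from.\<close>

lemma cost_of_one_step_push:
  fixes \<sigma> \<eta> :: real
  assumes \<beta>: "\<beta> > 0" and \<kappa>: "\<kappa> \<ge> 0" and r: "r \<ge> 0" and \<eta>: "\<eta> \<ge> 0"
    and X0: "X0 \<in> F 0 \<rightarrow>\<^sub>M borel" and law: "distr M borel X0 = \<mu>" and \<mu>: "\<mu> \<in> torus_prob"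
    and polar: "(\<integral>x. cos_torus x \<partial>\<mu>) = r * cos \<phi>" "(\<integral>x. sin_torus x \<partial>\<mu>) = r * sin \<phi>"
  shows "\<exists>a. progressively_measurable F a \<and>
    cost \<beta> \<sigma> M B \<kappa> (\<lambda>_. \<mu>) X0 a \<le>
      ereal (\<eta>\<^sup>2 * (1 + \<kappa> * r) / (2 * \<beta>)
        - \<kappa> * r * \<eta> * ((1 - exp (- 2 * \<sigma>\<^sup>2)) / 2 * exp (- \<sigma>\<^sup>2) * exp (- 3 * \<beta>)))"
proof -
  define \<theta> where "\<theta> = \<kappa> * r"
  define q where "q = (1 - exp (- 2 * \<sigma>\<^sup>2)) / 2"
  have \<theta>: "\<theta> \<ge> 0" using \<kappa> r by (simp add: \<theta>_def)
  have q: "q \<ge> 0" by (simp add: q_def)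
  define V where "V \<omega> = torus_angle (X0 \<omega>) - \<phi> + \<sigma> * B 0 \<omega>" for \<omega>
  define W where "W \<omega> = V \<omega> + \<sigma> * (B 1 \<omega> - B 0 \<omega>)" for \<omega>
  define S where "S \<omega> = sin (W \<omega>)" for \<omega>
  define G where "G j \<omega> = (if j = 1 then - \<eta> * S \<omega> else 0)" for j :: nat and \<omega>
  define a where "a = step_control 1 G"
  have BF: "B 0 \<in> borel_measurable (F 0)" "B 0 \<in> borel_measurable (F 1)" "B 1 \<in> borel_measurable (F 1)"
    by (rule B_measurable_F measurable_F_mono[OF B_measurable_F]; simp)+
  have VF0: "V \<in> borel_measurable (F 0)"
    unfolding V_def using X0 BF(1) by measurable
  then have VF1: "V \<in> borel_measurable (F 1)" by (rule measurable_F_mono) auto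
  have WF1: "W \<in> borel_measurable (F 1)"
    unfolding W_def using VF1 BF by measurable
  have SF1: "S \<in> borel_measurable (F 1)"
    unfolding S_def using WF1 by measurable
  note [measurable] = measurable_F[OF WF1, simplified] measurable_F[OF SF1, simplified] measurable_F[OF VF0, simplified]
  have GF: "G j \<in> borel_measurable (F (real j * 1))" for j
    unfolding G_def using SF1 by (cases "j = 1") simp_all
  have prog: "progressively_measurable F a"
    unfolding a_def by (rule step_control_progressive[OF _ GF]) simp
  have S1: "\<bar>S \<omega>\<bar> \<le> 1" for \<omega> by (simp add: S_def)
  have aK: "\<bar>a t \<omega>\<bar> \<le> \<eta>" for t \<omega>
    using mult_left_le[OF S1 \<eta>] \<eta> by (simp add: a_def step_control_def G_def abs_mult)
  have EV: "expectation (\<lambda>\<omega>. cos (V \<omega>)) = r"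
    unfolding V_def by (rule expectation_cos_initial[OF X0 law \<mu> polar])
  have Ecos: "expectation (\<lambda>\<omega>. cos (V \<omega> + \<sigma> * (B t \<omega> - B 0 \<omega>))) \<ge> 0" if "t \<ge> 0" for t
    using expectation_weighted_cos_add_increment[OF _ that VF0, of "\<lambda>_. 1" 1 \<sigma>] r by (simp add: EV)
  have ES: "expectation (\<lambda>\<omega>. (S \<omega>)\<^sup>2) \<ge> q"
  proof -
    have c2: "expectation (\<lambda>\<omega>. cos (2 * W \<omega>)) \<le> exp (- 2 * \<sigma>\<^sup>2)"
    proof -
      have "expectation (\<lambda>\<omega>. cos (2 * W \<omega>)) = expectation (\<lambda>\<omega>. 1 * cos (2 * V \<omega> + 2 * \<sigma> * (B 1 \<omega> - B 0 \<omega>)))"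
        by (simp add: W_def distrib_left mult.assoc)
      also have "\<dots> = exp (- (2 * \<sigma>)\<^sup>2 * (1 - 0) / 2) * expectation (\<lambda>\<omega>. 1 * cos (2 * V \<omega>))"
        by (rule expectation_weighted_cos_add_increment[where K=1]) (use VF0 in auto)
      also have "\<dots> \<le> exp (- (2 * \<sigma>)\<^sup>2 * (1 - 0) / 2) * expectation (\<lambda>\<omega>. 1)"
        by (intro mult_left_mono expectation_le_bounded_integrable[where K=1]) auto
      finally show ?thesis by (simp add: prob_space power2_eq_square)
    qed
    have i: "integrable M (\<lambda>\<omega>. cos (2 * W \<omega>))"
      by (rule integrable_const_bound[where B=1]) auto
    have "(S \<omega>)\<^sup>2 = 1 / 2 - cos (2 * W \<omega>) / 2" for \<omega>
      unfolding S_def cos_double_sin by (simp add: field_simps)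
    then have "expectation (\<lambda>\<omega>. (S \<omega>)\<^sup>2) = 1 / 2 - expectation (\<lambda>\<omega>. cos (2 * W \<omega>)) / 2"
      using i by (simp add: prob_space)
    then show ?thesis using c2 by (simp add: q_def)
  qed
  have iS: "integrable M (\<lambda>\<omega>. (S \<omega>)\<^sup>2)"
    by (rule integrable_const_bound[where B=1]) (auto simp: power_le_one_iff abs_square_le_1 S1)
  have main: "expectation (\<lambda>\<omega>. - \<theta> * cos (lifted_state \<sigma> X0 a t \<omega> - \<phi>) + (a t \<omega>)\<^sup>2 / 2)
      \<le> \<eta>\<^sup>2 * (1 + \<theta>) / 2 - \<theta> * \<eta> * q * exp (- \<sigma>\<^sup>2) * indicator {2..<3} t" if t: "t \<ge> 0" for t
  proof -
    define j where "j = nat \<lfloor>t / 1\<rfloor>"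
    have j: "real j * 1 \<le> t" "t < (real j + 1) * 1"
      using nat_floor_divide_bounds[OF _ t, of 1] by (simp_all add: j_def)
    define \<tau> where "\<tau> = (if j = 0 then 0 else min (t - 1) 1)"
    have \<tau>: "0 \<le> \<tau>" "\<tau> \<le> 1" using j by (auto simp: \<tau>_def)
    have dr: "(LBINT u:{0..t}. a u \<omega>) = - \<eta> * \<tau> * S \<omega>" for \<omega>
    proof -
      have "(\<Sum>i<j. G i \<omega>) = (if 1 < j then - \<eta> * S \<omega> else 0)"
        unfolding G_def by (simp add: sum.delta)
      moreover have "1 < j \<Longrightarrow> \<tau> = 1" using j by (auto simp: \<tau>_def min_def)
      moreover have "j = 1 \<Longrightarrow> \<tau> = t - 1" using j by (auto simp: \<tau>_def min_def)
      moreover have "j = 0 \<Longrightarrow> \<tau> = 0" by (simp add: \<tau>_def)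
      ultimately show ?thesis
        unfolding a_def step_control_drift[OF zero_less_one j]
        by (cases "j = 0"; cases "j = 1") (auto simp: G_def)
    qed
    define U where "U \<omega> = V \<omega> + \<sigma> * (B t \<omega> - B 0 \<omega>)" for \<omega>
    have st: "lifted_state \<sigma> X0 a t \<omega> - \<phi> = U \<omega> + (- \<eta> * \<tau> * S \<omega>)" for \<omega>
      unfolding lifted_state_def dr U_def V_def using t by (simp add: algebra_simps)
    have [measurable]: "B t \<in> borel_measurable M" "B 0 \<in> borel_measurable M"
      using t by (auto intro: B_measurable)
    have Um [measurable]: "U \<in> borel_measurable M" unfolding U_def by measurable
    have icU: "integrable M (\<lambda>\<omega>. cos (U \<omega>))"
      by (rule integrable_const_bound[where B=1]) auto
    have isU: "integrable M (\<lambda>\<omega>. S \<omega> * sin (U \<omega>))"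
      by (rule integrable_const_bound[where B=1]) (use S1 in \<open>auto simp: abs_mult intro!: mult_le_one\<close>)
    have pw: "- \<theta> * cos (U \<omega> + (- \<eta> * \<tau> * S \<omega>)) + (a t \<omega>)\<^sup>2 / 2
        \<le> - \<theta> * cos (U \<omega>) - \<theta> * \<eta> * \<tau> * (S \<omega> * sin (U \<omega>)) + \<eta>\<^sup>2 * (1 + \<theta>) / 2" for \<omega>
    proof -
      have "(- \<eta> * \<tau> * S \<omega>)\<^sup>2 \<le> \<eta>\<^sup>2"
      proof -
        have "\<bar>- \<eta> * \<tau> * S \<omega>\<bar> \<le> \<bar>\<eta>\<bar>"
          using \<tau> S1[of \<omega>] by (simp add: abs_mult mult.assoc mult_le_one mult_left_le)
        then show ?thesis by (rule abs_le_square_iff[THEN iffD1])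
      qed
      then have "cos (U \<omega>) + \<eta> * \<tau> * S \<omega> * sin (U \<omega>) - \<eta>\<^sup>2 / 2 \<le> cos (U \<omega> + (- \<eta> * \<tau> * S \<omega>))"
        using cos_add_ge_Taylor[of "U \<omega>" "- \<eta> * \<tau> * S \<omega>"] by simp
      from mult_left_mono[OF this \<theta>]
      have "\<theta> * cos (U \<omega>) + \<theta> * \<eta> * \<tau> * (S \<omega> * sin (U \<omega>)) - \<theta> * \<eta>\<^sup>2 / 2 \<le> \<theta> * cos (U \<omega> + (- \<eta> * \<tau> * S \<omega>))"
        by (simp add: algebra_simps)
      moreover have "(a t \<omega>)\<^sup>2 \<le> \<eta>\<^sup>2"
        using aK[of t \<omega>] \<eta> by (intro abs_le_square_iff[THEN iffD1]) simp
      moreover have "\<eta>\<^sup>2 * (1 + \<theta>) / 2 = \<eta>\<^sup>2 / 2 + \<theta> * \<eta>\<^sup>2 / 2" by (simp add: field_simps)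
      ultimately show ?thesis by linarith
    qed
    have am: "a t \<in> borel_measurable M"
      unfolding a_def step_control_def
      using measurable_F[OF GF, of "nat \<lfloor>t / 1\<rfloor>"] by simp
    have "expectation (\<lambda>\<omega>. - \<theta> * cos (lifted_state \<sigma> X0 a t \<omega> - \<phi>) + (a t \<omega>)\<^sup>2 / 2)
        \<le> expectation (\<lambda>\<omega>. - \<theta> * cos (U \<omega>) - \<theta> * \<eta> * \<tau> * (S \<omega> * sin (U \<omega>)) + \<eta>\<^sup>2 * (1 + \<theta>) / 2)"
      unfolding st
    proof (rule expectation_le_bounded_integrable[where K="\<theta> + \<eta>\<^sup>2 / 2"])
      show "(\<lambda>\<omega>. - \<theta> * cos (U \<omega> + - \<eta> * \<tau> * S \<omega>) + (a t \<omega>)\<^sup>2 / 2) \<in> borel_measurable M"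
        using am by measurable
      show "integrable M (\<lambda>\<omega>. - \<theta> * cos (U \<omega>) - \<theta> * \<eta> * \<tau> * (S \<omega> * sin (U \<omega>)) + \<eta>\<^sup>2 * (1 + \<theta>) / 2)"
        using icU isU by (intro Bochner_Integration.integrable_add Bochner_Integration.integrable_diff
            integrable_mult_right integrable_const)
      fix \<omega>
      have "\<bar>- \<theta> * cos (U \<omega> + - \<eta> * \<tau> * S \<omega>)\<bar> \<le> \<theta>"
        using \<theta> by (simp add: abs_mult mult_left_le)
      moreover have "(a t \<omega>)\<^sup>2 \<le> \<eta>\<^sup>2"
        using aK[of t \<omega>] \<eta> by (intro abs_le_square_iff[THEN iffD1]) simp
      moreover have "0 \<le> (a t \<omega>)\<^sup>2" by simp
      ultimately show "\<bar>- \<theta> * cos (U \<omega> + - \<eta> * \<tau> * S \<omega>) + (a t \<omega>)\<^sup>2 / 2\<bar> \<le> \<theta> + \<eta>\<^sup>2 / 2"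
        by linarith
    qed (rule pw)
    also have "\<dots> = - \<theta> * expectation (\<lambda>\<omega>. cos (U \<omega>)) - \<theta> * \<eta> * \<tau> * expectation (\<lambda>\<omega>. S \<omega> * sin (U \<omega>)) + \<eta>\<^sup>2 * (1 + \<theta>) / 2"
      using icU isU by (simp add: prob_space)
    finally have le: "expectation (\<lambda>\<omega>. - \<theta> * cos (lifted_state \<sigma> X0 a t \<omega> - \<phi>) + (a t \<omega>)\<^sup>2 / 2)
      \<le> - \<theta> * expectation (\<lambda>\<omega>. cos (U \<omega>)) - \<theta> * \<eta> * \<tau> * expectation (\<lambda>\<omega>. S \<omega> * sin (U \<omega>)) + \<eta>\<^sup>2 * (1 + \<theta>) / 2" .
    have c0: "0 \<le> \<theta> * expectation (\<lambda>\<omega>. cos (U \<omega>))"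
      using Ecos[OF t] \<theta> by (simp add: U_def)
    have s0: "\<theta> * \<eta> * q * exp (- \<sigma>\<^sup>2) * indicator {2..<3} t \<le> \<theta> * \<eta> * \<tau> * expectation (\<lambda>\<omega>. S \<omega> * sin (U \<omega>))"
    proof (cases "t < 1")
      case True
      then have "j = 0" using j by simp
      then show ?thesis using True by (simp add: \<tau>_def)
    next
      case False
      then have t1: "1 \<le> t" by simp
      have "expectation (\<lambda>\<omega>. S \<omega> * sin (U \<omega>)) = expectation (\<lambda>\<omega>. S \<omega> * cos ((W \<omega> - pi / 2) + \<sigma> * (B t \<omega> - B 1 \<omega>)))"
      proof -
        have e: "(W \<omega> - pi / 2) + \<sigma> * (B t \<omega> - B 1 \<omega>) = U \<omega> - pi / 2" for \<omega>
          by (simp add: W_def U_def algebra_simps)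
        show ?thesis unfolding e by (simp add: cos_diff)
      qed
      also have "\<dots> = exp (- \<sigma>\<^sup>2 * (t - 1) / 2) * expectation (\<lambda>\<omega>. S \<omega> * cos (W \<omega> - pi / 2))"
        by (rule expectation_weighted_cos_add_increment[where K=1]) (use WF1 SF1 S1 t1 in auto)
      also have "(\<lambda>\<omega>. S \<omega> * cos (W \<omega> - pi / 2)) = (\<lambda>\<omega>. (S \<omega>)\<^sup>2)"
        by (simp add: cos_diff S_def power2_eq_square)
      finally have E: "expectation (\<lambda>\<omega>. S \<omega> * sin (U \<omega>)) = exp (- \<sigma>\<^sup>2 * (t - 1) / 2) * expectation (\<lambda>\<omega>. (S \<omega>)\<^sup>2)" .
      show ?thesis
      proof (cases "t \<in> {2..<3}")
        case True
        then have "\<tau> = 1" using j by (auto simp: \<tau>_def)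
        have "exp (- \<sigma>\<^sup>2) \<le> exp (- \<sigma>\<^sup>2 * (t - 1) / 2)"
        proof -
          have "\<sigma>\<^sup>2 * (t - 1) \<le> \<sigma>\<^sup>2 * 2" using True by (intro mult_left_mono) auto
          then show ?thesis by simp
        qed
        then have "exp (- \<sigma>\<^sup>2) * q \<le> expectation (\<lambda>\<omega>. S \<omega> * sin (U \<omega>))"
          unfolding E using ES q by (intro mult_mono) auto
        then have "\<theta> * \<eta> * (exp (- \<sigma>\<^sup>2) * q) \<le> \<theta> * \<eta> * expectation (\<lambda>\<omega>. S \<omega> * sin (U \<omega>))"
          using \<theta> \<eta> by (intro mult_left_mono) auto
        then show ?thesis using True \<open>\<tau> = 1\<close> by (simp add: mult_ac)
      next
        case False
        have "0 \<le> expectation (\<lambda>\<omega>. S \<omega> * sin (U \<omega>))" unfolding E using ES q by simp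
        then show ?thesis using False \<theta> \<eta> \<tau> by simp
      qed
    qed
    show ?thesis using le c0 s0 by linarith
  qed
  have "cost \<beta> \<sigma> M B \<kappa> (\<lambda>_. \<mu>) X0 a \<le>
      ereal (\<eta>\<^sup>2 * (1 + \<theta>) / 2 / \<beta> + (- \<theta> * \<eta> * q * exp (- \<sigma>\<^sup>2) * exp (- 3 * \<beta>)) * (3 - 2))"
  proof (rule cost_le_of_bounded_control[OF \<beta> polar prog X0 aK])
    fix t :: real assume t: "t \<ge> 0"
    have "exp (- \<beta> * t) * expectation (\<lambda>\<omega>. - (\<kappa> * r) * cos (lifted_state \<sigma> X0 a t \<omega> - \<phi>) + (a t \<omega>)\<^sup>2 / 2)
      \<le> exp (- \<beta> * t) * (\<eta>\<^sup>2 * (1 + \<theta>) / 2 - \<theta> * \<eta> * q * exp (- \<sigma>\<^sup>2) * indicator {2..<3} t)"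
      using main[OF t] by (intro mult_left_mono) (simp_all add: \<theta>_def)
    also have "\<dots> = \<eta>\<^sup>2 * (1 + \<theta>) / 2 * exp (- \<beta> * t) - \<theta> * \<eta> * q * exp (- \<sigma>\<^sup>2) * (exp (- \<beta> * t) * indicator {2..<3} t)"
      by (simp add: algebra_simps)
    also have "\<dots> \<le> \<eta>\<^sup>2 * (1 + \<theta>) / 2 * exp (- \<beta> * t) - \<theta> * \<eta> * q * exp (- \<sigma>\<^sup>2) * (exp (- 3 * \<beta>) * indicator {2..<3} t)"
    proof -
      have "exp (- 3 * \<beta>) * indicator {2..<3} t \<le> exp (- \<beta> * t) * (indicator {2..<3} t :: real)"
        using \<beta> by (auto simp: indicator_def)
      moreover have "0 \<le> \<theta> * \<eta> * q * exp (- \<sigma>\<^sup>2)" using \<theta> \<eta> q by simp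
      ultimately show ?thesis by (intro diff_left_mono mult_left_mono)
    qed
    finally show "exp (- \<beta> * t) * expectation (\<lambda>\<omega>. - (\<kappa> * r) * cos (lifted_state \<sigma> X0 a t \<omega> - \<phi>) + (a t \<omega>)\<^sup>2 / 2)
      \<le> \<eta>\<^sup>2 * (1 + \<theta>) / 2 * exp (- \<beta> * t) + (- \<theta> * \<eta> * q * exp (- \<sigma>\<^sup>2) * exp (- 3 * \<beta>)) * indicator {2..<3} t"
      by (simp add: mult.assoc)
  qed auto
  moreover have "\<eta>\<^sup>2 * (1 + \<theta>) / 2 / \<beta> + (- \<theta> * \<eta> * q * exp (- \<sigma>\<^sup>2) * exp (- 3 * \<beta>)) * (3 - 2)
      = \<eta>\<^sup>2 * (1 + \<kappa> * r) / (2 * \<beta>) - \<kappa> * r * \<eta> * ((1 - exp (- 2 * \<sigma>\<^sup>2)) / 2 * exp (- \<sigma>\<^sup>2) * exp (- 3 * \<beta>))"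
    unfolding q_def \<theta>_def by simp
  ultimately show ?thesis using prog by metis
qed

end

section \<open>Periodic resetting: strong coupling concentrates the law\<close>

context filtered_brownian begin

text \<open>Divide time into intervals of length \<open>h\<close>, and let \<open>w\<^sub>j\<close> be the representative in \<open>[- pi, pi]\<close> of the displacement
  from \<open>\<phi>\<close> at the start of interval \<open>j\<close>. The constant control \<open>- w\<^sub>j / h\<close> would remove it exactly by the end of
  the interval, so up to full turns the displacement found there is the noise of that interval alone,
  which is \<open>Z\<close> below. From the second interval on, displacements therefore have second
  moment of order \<open>\<sigma>\<^sup>2 h\<close> and controls have second moment at most \<open>\<sigma>\<^sup>2 / h\<close>. In the first interval the
  crude bounds \<open>\<theta>\<close> and \<open>pi / h\<close> are used, whose price is spread over a time \<open>h\<close> only.\<close>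

lemma cost_of_resetting_control:
  fixes \<sigma> h :: real
  assumes \<beta>: "\<beta> > 0" and \<kappa>: "\<kappa> \<ge> 0" and r: "r \<ge> 0" and h: "h > 0"
    and X0: "X0 \<in> F 0 \<rightarrow>\<^sub>M borel"
    and polar: "(\<integral>x. cos_torus x \<partial>\<mu>) = r * cos \<phi>" "(\<integral>x. sin_torus x \<partial>\<mu>) = r * sin \<phi>"
  shows "\<exists>a. progressively_measurable F a \<and>
    cost \<beta> \<sigma> M B \<kappa> (\<lambda>_. \<mu>) X0 a \<le>
      ereal ((- (\<kappa> * r) + 2 * (\<kappa> * r) * \<sigma>\<^sup>2 * h + \<sigma>\<^sup>2 / (2 * h)) / \<beta> + 2 * (\<kappa> * r) * h + pi\<^sup>2 / (2 * h))"
proof -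
  define \<theta> where "\<theta> = \<kappa> * r"
  have \<theta>: "\<theta> \<ge> 0" using \<kappa> r by (simp add: \<theta>_def)
  define V where "V \<omega> = torus_angle (X0 \<omega>) - \<phi> + \<sigma> * B 0 \<omega>" for \<omega>
  define Z where "Z j \<omega> = (if j = 0 then V \<omega> else \<sigma> * (B (real j * h) \<omega> - B (real (j - 1) * h) \<omega>))"
    for j :: nat and \<omega>
  define w where "w j \<omega> = torus_angle (to_torus (Z j \<omega>))" for j \<omega>
  define a where "a = step_control h (\<lambda>j \<omega>. - w j \<omega> / h)"
  have jh: "0 \<le> real j * h" for j using h by simp
  have ZF: "Z j \<in> borel_measurable (F (real j * h))" for j
  proof (cases "j = 0")
    case True
    have "V \<in> borel_measurable (F 0)"
      unfolding V_def using X0 B_measurable_F[of 0] by measurable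
    moreover have "Z 0 = V" by (simp add: fun_eq_iff Z_def)
    ultimately show ?thesis using True by simp
  next
    case False
    have m1: "B (real (j - 1) * h) \<in> borel_measurable (F (real j * h))"
      by (rule measurable_F_mono[OF B_measurable_F]) (use h in \<open>auto intro: mult_right_mono\<close>)
    have m2: "B (real j * h) \<in> borel_measurable (F (real j * h))"
      by (rule B_measurable_F[OF jh])
    have "Z j = (\<lambda>\<omega>. \<sigma> * (B (real j * h) \<omega> - B (real (j - 1) * h) \<omega>))"
      using False by (simp add: fun_eq_iff Z_def)
    then show ?thesis using m1 m2 by simp
  qed
  have wF: "w j \<in> borel_measurable (F (real j * h))" for j
    unfolding w_def using ZF[of j] by measurable
  have wm [measurable]: "w j \<in> borel_measurable M" for j by (rule measurable_F[OF wF jh])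
  have prog: "progressively_measurable F a"
    unfolding a_def by (rule step_control_progressive[OF h]) (use wF in measurable)
  have wpi: "\<bar>w j \<omega>\<bar> \<le> pi" for j \<omega> by (simp add: w_def abs_torus_angle_le)
  have aK: "\<bar>a t \<omega>\<bar> \<le> pi / h" for t \<omega>
    using wpi h by (simp add: a_def step_control_def divide_right_mono)
  \<comment> \<open>Each reset removes its displacement up to full turns.\<close>
  have tele: "to_torus (\<Sum>i<j. Z i \<omega> - w i \<omega>) = 0" for j \<omega>
  proof (induction j)
    case 0 show ?case by (simp add: zero_torus.abs_eq)
  next
    case (Suc j)
    have "to_torus (Z j \<omega> - w j \<omega>) + to_torus (w j \<omega>) = to_torus (Z j \<omega>)"
      by (simp flip: to_torus_add)
    then have "to_torus (Z j \<omega> - w j \<omega>) = 0"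
      by (simp add: w_def torus_angle_to_torus)
    then show ?case using Suc by (simp add: to_torus_add)
  qed
  have sumZ: "(\<Sum>i<Suc j. Z i \<omega>) = torus_angle (X0 \<omega>) - \<phi> + \<sigma> * B (real j * h) \<omega>" for j \<omega>
    by (induction j) (simp_all add: Z_def V_def algebra_simps)
  have main: "expectation (\<lambda>\<omega>. - \<theta> * cos (lifted_state \<sigma> X0 a t \<omega> - \<phi>) + (a t \<omega>)\<^sup>2 / 2)
      \<le> - \<theta> + 2 * \<theta> * \<sigma>\<^sup>2 * h + \<sigma>\<^sup>2 / (2 * h) + (2 * \<theta> + pi\<^sup>2 / (2 * h\<^sup>2)) * indicator {0..<h} t" if t: "t \<ge> 0" for t
  proof -
    define j where "j = nat \<lfloor>t / h\<rfloor>"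
    have j: "real j * h \<le> t" "t < (real j + 1) * h"
      using nat_floor_divide_bounds[OF h t] by (simp_all add: j_def)
    \<comment> \<open>the fraction of the displacement that is still to be removed at time \<open>t\<close>\<close>
    define p where "p = 1 - (t - real j * h) / h"
    have p: "0 \<le> p" "p \<le> 1"
      using j h by (simp_all add: p_def field_simps)
    define D where "D \<omega> = B t \<omega> - B (real j * h) \<omega>" for \<omega>
    have at: "a t \<omega> = - w j \<omega> / h" for \<omega> by (simp add: a_def step_control_def j_def)
    have cosX: "cos (lifted_state \<sigma> X0 a t \<omega> - \<phi>) = cos (p * w j \<omega> + \<sigma> * D \<omega>)" for \<omega>
    proof -
      have dr: "(LBINT u:{0..t}. a u \<omega>) = - (\<Sum>i<Suc j. w i \<omega>) + p * w j \<omega>"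
        unfolding a_def step_control_drift[OF h j] p_def using h
        by (simp add: sum_distrib_left sum_negf left_diff_distrib) 
      have "lifted_state \<sigma> X0 a t \<omega> - \<phi> = (\<Sum>i<Suc j. Z i \<omega>) - (\<Sum>i<Suc j. w i \<omega>) + (p * w j \<omega> + \<sigma> * D \<omega>)"
        unfolding lifted_state_def dr sumZ D_def max_absorb2[OF t] by (simp add: right_diff_distrib)
      then have "lifted_state \<sigma> X0 a t \<omega> - \<phi> = (\<Sum>i<Suc j. Z i \<omega> - w i \<omega>) + (p * w j \<omega> + \<sigma> * D \<omega>)"
        by (simp only: sum_subtractf)
      then have "to_torus (lifted_state \<sigma> X0 a t \<omega> - \<phi>) = to_torus (p * w j \<omega> + \<sigma> * D \<omega>)"
        by (simp only: to_torus_add[of "\<Sum>i<Suc j. Z i \<omega> - w i \<omega>"] tele add_0)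
      then show ?thesis by (rule cos_eq_if_to_torus_eq)
    qed
    have [measurable]: "B t \<in> borel_measurable M" "B (real j * h) \<in> borel_measurable M"
      using t jh by (auto intro: B_measurable)
    have Dm [measurable]: "D \<in> borel_measurable M" unfolding D_def by measurable
    have fm: "(\<lambda>\<omega>. - \<theta> * cos (p * w j \<omega> + \<sigma> * D \<omega>) + (- w j \<omega> / h)\<^sup>2 / 2) \<in> borel_measurable M"
      by measurable
    have w2: "(w j \<omega>)\<^sup>2 \<le> pi\<^sup>2" for \<omega>
      using wpi[of j \<omega>] by (intro abs_le_square_iff[THEN iffD1]) simp
    have a2: "(- w j \<omega> / h)\<^sup>2 / 2 \<le> pi\<^sup>2 / (2 * h\<^sup>2)" for \<omega>
      using divide_right_mono[OF w2[of \<omega>], of "2 * h\<^sup>2"] by (simp add: power_divide mult.commute)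
    have c1: "\<bar>- \<theta> * cos x\<bar> \<le> \<theta>" for x
      using \<theta> by (simp add: abs_mult mult_left_le)
    have fK: "\<bar>- \<theta> * cos (p * w j \<omega> + \<sigma> * D \<omega>) + (- w j \<omega> / h)\<^sup>2 / 2\<bar> \<le> \<theta> + pi\<^sup>2 / (2 * h\<^sup>2)" for \<omega>
    proof -
      have "0 \<le> (- w j \<omega> / h)\<^sup>2 / 2" by simp
      then show ?thesis using a2[of \<omega>] c1[of "p * w j \<omega> + \<sigma> * D \<omega>"] by linarith
    qed
    show ?thesis
    proof (cases "j = 0")
      case True
      have "expectation (\<lambda>\<omega>. - \<theta> * cos (p * w j \<omega> + \<sigma> * D \<omega>) + (- w j \<omega> / h)\<^sup>2 / 2)
          \<le> expectation (\<lambda>\<omega>. \<theta> + pi\<^sup>2 / (2 * h\<^sup>2))"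
      proof (rule expectation_le_bounded_integrable[OF fm fK])
        show "- \<theta> * cos (p * w j \<omega> + \<sigma> * D \<omega>) + (- w j \<omega> / h)\<^sup>2 / 2 \<le> \<theta> + pi\<^sup>2 / (2 * h\<^sup>2)" for \<omega>
          using fK[of \<omega>] by linarith
      qed simp
      also have "\<dots> = \<theta> + pi\<^sup>2 / (2 * h\<^sup>2)" by (simp add: prob_space)
      also have "\<dots> \<le> - \<theta> + 2 * \<theta> * \<sigma>\<^sup>2 * h + \<sigma>\<^sup>2 / (2 * h) + (2 * \<theta> + pi\<^sup>2 / (2 * h\<^sup>2)) * indicator {0..<h} t"
      proof -
        have "t \<in> {0..<h}" using j True t by simp
        moreover have "0 \<le> 2 * \<theta> * \<sigma>\<^sup>2 * h" "0 \<le> \<sigma>\<^sup>2 / (2 * h)" using \<theta> h by simp_all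
        ultimately show ?thesis by simp
      qed
      finally show ?thesis unfolding cosX at .
    next
      case False
      let ?s = "real (j - 1) * h"
      have sj: "0 \<le> ?s" "?s \<le> real j * h" "real j * h - ?s = h"
        using False h by (auto simp: mult_right_mono of_nat_diff left_diff_distrib Suc_leI)
      have iZ: "integrable M (\<lambda>\<omega>. (Z j \<omega>)\<^sup>2)" and EZ: "expectation (\<lambda>\<omega>. (Z j \<omega>)\<^sup>2) = \<sigma>\<^sup>2 * h"
        using integrable_increment_square[OF sj(1,2)] expectation_increment_square[OF sj(1,2)] sj(3) False
        by (simp_all add: Z_def power_mult_distrib)
      have iD: "integrable M (\<lambda>\<omega>. (D \<omega>)\<^sup>2)" and ED: "expectation (\<lambda>\<omega>. (D \<omega>)\<^sup>2) \<le> h"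
        using integrable_increment_square[OF jh j(1)] expectation_increment_square[OF jh j(1)] j(2) by (simp_all add: D_def algebra_simps)
      have pw: "- \<theta> * cos (p * w j \<omega> + \<sigma> * D \<omega>) + (- w j \<omega> / h)\<^sup>2 / 2
          \<le> - \<theta> + (\<theta> + 1 / (2 * h\<^sup>2)) * (Z j \<omega>)\<^sup>2 + \<theta> * \<sigma>\<^sup>2 * (D \<omega>)\<^sup>2" for \<omega>
      proof -
        have wZ: "(w j \<omega>)\<^sup>2 \<le> (Z j \<omega>)\<^sup>2" unfolding w_def by (rule torus_angle_to_torus_square_le)
        have "p\<^sup>2 * (w j \<omega>)\<^sup>2 \<le> 1 * (Z j \<omega>)\<^sup>2"
          using wZ p by (intro mult_mono) (auto simp: power_le_one_iff)
        then have lw: "(p * w j \<omega>)\<^sup>2 \<le> (Z j \<omega>)\<^sup>2" by (simp add: power_mult_distrib)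
        have "0 \<le> (p * w j \<omega> - \<sigma> * D \<omega>)\<^sup>2" by simp
        then have "(p * w j \<omega> + \<sigma> * D \<omega>)\<^sup>2 \<le> 2 * (p * w j \<omega>)\<^sup>2 + 2 * (\<sigma> * D \<omega>)\<^sup>2"
          unfolding power2_sum power2_diff by linarith
        then have "1 - cos (p * w j \<omega> + \<sigma> * D \<omega>) \<le> (Z j \<omega>)\<^sup>2 + (\<sigma> * D \<omega>)\<^sup>2"
          using one_minus_cos_le[of "p * w j \<omega> + \<sigma> * D \<omega>"] lw by linarith
        from mult_left_mono[OF this \<theta>]
        have "- \<theta> * cos (p * w j \<omega> + \<sigma> * D \<omega>) \<le> - \<theta> + \<theta> * (Z j \<omega>)\<^sup>2 + \<theta> * \<sigma>\<^sup>2 * (D \<omega>)\<^sup>2"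
          by (simp add: right_diff_distrib distrib_left power_mult_distrib mult.assoc)
        moreover have "(- w j \<omega> / h)\<^sup>2 / 2 \<le> 1 / (2 * h\<^sup>2) * (Z j \<omega>)\<^sup>2"
          using divide_right_mono[OF wZ, of "2 * h\<^sup>2"] by (simp add: power_divide mult.commute)
        ultimately show ?thesis unfolding distrib_right by linarith
      qed
      have "expectation (\<lambda>\<omega>. - \<theta> * cos (p * w j \<omega> + \<sigma> * D \<omega>) + (- w j \<omega> / h)\<^sup>2 / 2)
          \<le> expectation (\<lambda>\<omega>. - \<theta> + (\<theta> + 1 / (2 * h\<^sup>2)) * (Z j \<omega>)\<^sup>2 + \<theta> * \<sigma>\<^sup>2 * (D \<omega>)\<^sup>2)"
        by (rule expectation_le_bounded_integrable[OF fm fK _ pw])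
           (intro Bochner_Integration.integrable_add integrable_mult_right iZ iD integrable_const)
      also have "\<dots> = - \<theta> + (\<theta> + 1 / (2 * h\<^sup>2)) * (\<sigma>\<^sup>2 * h) + \<theta> * \<sigma>\<^sup>2 * expectation (\<lambda>\<omega>. (D \<omega>)\<^sup>2)"
        using iZ iD by (simp add: prob_space EZ)
      also have "\<dots> \<le> - \<theta> + (\<theta> + 1 / (2 * h\<^sup>2)) * (\<sigma>\<^sup>2 * h) + \<theta> * \<sigma>\<^sup>2 * h"
        using ED \<theta> by (intro add_left_mono mult_left_mono) auto
      also have "\<dots> = - \<theta> + 2 * \<theta> * \<sigma>\<^sup>2 * h + \<sigma>\<^sup>2 / (2 * h)"
        using h by (simp add: field_simps power2_eq_square)
      also have "\<dots> \<le> - \<theta> + 2 * \<theta> * \<sigma>\<^sup>2 * h + \<sigma>\<^sup>2 / (2 * h) + (2 * \<theta> + pi\<^sup>2 / (2 * h\<^sup>2)) * indicator {0..<h} t"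
        using \<theta> by simp
      finally show ?thesis unfolding cosX at .
    qed
  qed
  let ?c = "- \<theta> + 2 * \<theta> * \<sigma>\<^sup>2 * h + \<sigma>\<^sup>2 / (2 * h)" and ?d = "2 * \<theta> + pi\<^sup>2 / (2 * h\<^sup>2)"
  have "cost \<beta> \<sigma> M B \<kappa> (\<lambda>_. \<mu>) X0 a \<le> ereal (?c / \<beta> + ?d * (h - 0))"
  proof (rule cost_le_of_bounded_control[OF \<beta> polar prog X0 aK])
    fix t :: real assume t: "t \<ge> 0"
    have "exp (- \<beta> * t) * expectation (\<lambda>\<omega>. - (\<kappa> * r) * cos (lifted_state \<sigma> X0 a t \<omega> - \<phi>) + (a t \<omega>)\<^sup>2 / 2)
      \<le> exp (- \<beta> * t) * (?c + ?d * indicator {0..<h} t)"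
      using main[OF t] by (intro mult_left_mono) (simp_all add: \<theta>_def)
    also have "\<dots> = ?c * exp (- \<beta> * t) + exp (- \<beta> * t) * (?d * indicator {0..<h} t)"
      by (simp only: distrib_left mult.commute)
    also have "\<dots> \<le> ?c * exp (- \<beta> * t) + 1 * (?d * indicator {0..<h} t)"
      using \<beta> t \<theta> by (intro add_left_mono mult_right_mono) auto
    finally show "exp (- \<beta> * t) * expectation (\<lambda>\<omega>. - (\<kappa> * r) * cos (lifted_state \<sigma> X0 a t \<omega> - \<phi>) + (a t \<omega>)\<^sup>2 / 2)
      \<le> ?c * exp (- \<beta> * t) + ?d * indicator {0..<h} t" by simp
  qed (use h in auto)
  moreover have "?d * (h - 0) = 2 * \<theta> * h + pi\<^sup>2 / (2 * h)"
    using h by (simp add: field_simps power2_eq_square)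
  ultimately have "cost \<beta> \<sigma> M B \<kappa> (\<lambda>_. \<mu>) X0 a \<le> ereal (?c / \<beta> + (2 * \<theta> * h + pi\<^sup>2 / (2 * h)))"
    by metis
  then show ?thesis using prog unfolding \<theta>_def by (metis add.assoc)
qed

end

section \<open>Stationary solutions for large interaction\<close>

context filtered_brownian begin

lemma stationary_solution_obtain:
  assumes "stationary_solution \<beta> \<sigma> M F B \<kappa> \<mu>"
  obtains X0 \<alpha> where "X0 \<in> F 0 \<rightarrow>\<^sub>M borel" "distr M borel X0 = \<mu>" "progressively_measurable F \<alpha>"
    "\<And>a. progressively_measurable F a \<Longrightarrow> cost \<beta> \<sigma> M B \<kappa> (\<lambda>_. \<mu>) X0 \<alpha> \<le> cost \<beta> \<sigma> M B \<kappa> (\<lambda>_. \<mu>) X0 a"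
    "\<And>t. t \<ge> 0 \<Longrightarrow> distr M borel (state \<sigma> B X0 \<alpha> t) = \<mu>"
proof -
  obtain X0 \<alpha> where X0: "initial_state M F \<mu> X0" and \<alpha>: "progressively_measurable F \<alpha>"
    and opt: "cost \<beta> \<sigma> M B \<kappa> (\<lambda>_. \<mu>) X0 \<alpha>
      = (INF a\<in>{a. progressively_measurable F a}. cost \<beta> \<sigma> M B \<kappa> (\<lambda>_. \<mu>) X0 a)"
    and law: "\<And>t. t \<ge> 0 \<Longrightarrow> distr M borel (state \<sigma> B X0 \<alpha> t) = \<mu>"
    using assms unfolding stationary_solution_def mfg_solution_def by blast
  have "cost \<beta> \<sigma> M B \<kappa> (\<lambda>_. \<mu>) X0 \<alpha> \<le> cost \<beta> \<sigma> M B \<kappa> (\<lambda>_. \<mu>) X0 a"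
    if "progressively_measurable F a" for a
    unfolding opt using that by (intro INF_lower) simp
  then show ?thesis
    using that X0 \<alpha> law unfolding initial_state_def by blast
qed

text \<open>With vanishing first Fourier coefficient nothing is gained by moving, so the zero control is optimal with cost
  \<open>0\<close>, every optimal control has no drift, and the law of the state is invariant under pure noise.\<close>

lemma uniform_if_order_parameter_zero:
  assumes \<beta>: "\<beta> > 0" and \<sigma>: "\<sigma> > 0" and \<mu>: "\<mu> \<in> torus_prob"
    and sol: "stationary_solution \<beta> \<sigma> M F B \<kappa> \<mu>"
    and polar: "(\<integral>x. cos_torus x \<partial>\<mu>) = 0" "(\<integral>x. sin_torus x \<partial>\<mu>) = 0"
  shows "\<mu> = uniform_torus"
proof -
  obtain X0 \<alpha> where X0: "X0 \<in> F 0 \<rightarrow>\<^sub>M borel" and \<alpha>: "progressively_measurable F \<alpha>"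
    and opt: "\<And>a. progressively_measurable F a \<Longrightarrow> cost \<beta> \<sigma> M B \<kappa> (\<lambda>_. \<mu>) X0 \<alpha> \<le> cost \<beta> \<sigma> M B \<kappa> (\<lambda>_. \<mu>) X0 a"
    and law: "\<And>t. t \<ge> 0 \<Longrightarrow> distr M borel (state \<sigma> B X0 \<alpha> t) = \<mu>"
    by (rule stationary_solution_obtain[OF sol]) blast
  have z: "progressively_measurable F (\<lambda>_ _. 0)"
    unfolding progressively_measurable_def by simp
  have "cost \<beta> \<sigma> M B \<kappa> (\<lambda>_. \<mu>) X0 (\<lambda>_ _. 0) = 0"
    unfolding cost_def running_cost_def polar by (simp add: ereal_integral_def zero_ennreal.rep_eq)
  then have c: "cost \<beta> \<sigma> M B \<kappa> (\<lambda>_. \<mu>) X0 \<alpha> \<le> 0" using opt[OF z] by simp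
  have X0m: "X0 \<in> M \<rightarrow>\<^sub>M borel" by (rule measurable_F[OF X0]) simp
  show ?thesis
  proof (rule uniform_if_law_of_brownian_invariant[OF X0 \<sigma> \<mu>])
    fix t :: real assume "t > 0"
    then have t: "t \<ge> 0" by simp
    have m1: "state \<sigma> B X0 \<alpha> t \<in> M \<rightarrow>\<^sub>M borel"
      unfolding state_eq_lifted[OF t] by (intro measurable_compose[OF lifted_state_measurable[OF \<alpha> X0]]) simp
    have e: "X0 \<omega> + to_torus (\<sigma> * B t \<omega>) = to_torus (torus_angle (X0 \<omega>) + \<sigma> * B t \<omega>)" for \<omega>
      by (simp only: to_torus_add torus_angle_to_torus)
    have m2: "(\<lambda>\<omega>. X0 \<omega> + to_torus (\<sigma> * B t \<omega>)) \<in> M \<rightarrow>\<^sub>M borel"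
      unfolding e using X0m B_measurable[OF t] by measurable
    have "AE \<omega> in M. X0 \<omega> + to_torus (\<sigma> * B t \<omega>) = state \<sigma> B X0 \<alpha> t \<omega>"
      using zero_cost_control_has_no_drift[OF polar \<alpha> c] by eventually_elim (simp add: state_def)
    then have "distr M borel (\<lambda>\<omega>. X0 \<omega> + to_torus (\<sigma> * B t \<omega>)) = distr M borel (state \<sigma> B X0 \<alpha> t)"
      using m1 m2 by (intro distr_cong_AE) auto
    then show "distr M borel (\<lambda>\<omega>. X0 \<omega> + to_torus (\<sigma> * B t \<omega>)) = \<mu>" using law[OF t] by simp
  qed
qed

text \<open>Compare the lower bound \<open>- \<theta> r / \<beta>\<close> with the cost of the small push, at the amplitude \<open>\<eta>\<close> that minimises the
  latter. The resulting inequality has a factor \<open>r\<close> on both sides, which cancels as \<open>r > 0\<close>.\<close>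

lemma effective_coupling_lower_bound:
  assumes \<beta>: "\<beta> > 0" and \<kappa>: "\<kappa> > 0" and r: "r > 0" and \<mu>: "\<mu> \<in> torus_prob"
    and sol: "stationary_solution \<beta> \<sigma> M F B \<kappa> \<mu>"
    and polar: "(\<integral>x. cos_torus x \<partial>\<mu>) = r * cos \<phi>" "(\<integral>x. sin_torus x \<partial>\<mu>) = r * sin \<phi>"
    and Q: "Q = (1 - exp (- 2 * \<sigma>\<^sup>2)) / 2 * exp (- \<sigma>\<^sup>2) * exp (- 3 * \<beta>)"
  shows "(Q * \<beta>)\<^sup>2 / 2 * \<kappa> \<le> 1 + \<kappa> * r"
proof -
  obtain X0 \<alpha> where X0: "X0 \<in> F 0 \<rightarrow>\<^sub>M borel" "distr M borel X0 = \<mu>" and \<alpha>: "progressively_measurable F \<alpha>"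
    and opt: "\<And>a. progressively_measurable F a \<Longrightarrow> cost \<beta> \<sigma> M B \<kappa> (\<lambda>_. \<mu>) X0 \<alpha> \<le> cost \<beta> \<sigma> M B \<kappa> (\<lambda>_. \<mu>) X0 a"
    and law: "\<And>t. t \<ge> 0 \<Longrightarrow> distr M borel (state \<sigma> B X0 \<alpha> t) = \<mu>"
    by (rule stationary_solution_obtain[OF sol]) blast
  define \<theta> where "\<theta> = \<kappa> * r"
  have \<theta>: "\<theta> > 0" using \<kappa> r by (simp add: \<theta>_def)
  define \<eta> where "\<eta> = \<theta> * Q * \<beta> / (1 + \<theta>)"
  have Q0: "Q \<ge> 0" unfolding Q by simp
  have \<eta>: "\<eta> \<ge> 0" using \<theta> Q0 \<beta> by (simp add: \<eta>_def)
  obtain a where a: "progressively_measurable F a"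
    "cost \<beta> \<sigma> M B \<kappa> (\<lambda>_. \<mu>) X0 a \<le> ereal (\<eta>\<^sup>2 * (1 + \<theta>) / (2 * \<beta>) - \<theta> * \<eta> * Q)"
    using cost_of_one_step_push[OF \<beta> _ _ \<eta> X0 \<mu> polar, of \<kappa> \<sigma>] \<kappa> r unfolding \<theta>_def Q by auto
  have "ereal (- (\<kappa> * r) * r / \<beta>) \<le> cost \<beta> \<sigma> M B \<kappa> (\<lambda>_. \<mu>) X0 \<alpha>"
    by (rule cost_ge_of_stationary[OF \<beta> polar \<mu> \<alpha> X0(1) law])
  from order_trans[OF this order_trans[OF opt[OF a(1)] a(2)]]
  have "- \<theta> * r / \<beta> \<le> \<eta>\<^sup>2 * (1 + \<theta>) / (2 * \<beta>) - \<theta> * \<eta> * Q"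
    by (simp only: \<theta>_def ereal_less_eq)
  also have "\<eta>\<^sup>2 * (1 + \<theta>) / (2 * \<beta>) = \<theta> * \<eta> * Q / 2"
  proof -
    have "\<eta> * (1 + \<theta>) = \<theta> * Q * \<beta>" using \<theta> by (simp add: \<eta>_def)
    then have "\<eta>\<^sup>2 * (1 + \<theta>) = \<eta> * (\<theta> * Q * \<beta>)" by (simp add: power2_eq_square mult.assoc)
    then show ?thesis using \<beta> by simp
  qed
  finally have "- \<theta> * r / \<beta> \<le> \<theta> * \<eta> * Q / 2 - \<theta> * \<eta> * Q" .
  then have "\<theta> * \<eta> * Q / 2 \<le> \<theta> * r / \<beta>"
    unfolding mult_minus_left divide_minus_left by linarith
  then have "\<theta> * (\<eta> * Q * \<beta> / 2) \<le> \<theta> * r" using \<beta> by (simp add: field_simps)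
  then have "\<eta> * Q * \<beta> / 2 \<le> r" using \<theta> by simp
  then have "\<theta> * (Q * \<beta>)\<^sup>2 / 2 / (1 + \<theta>) \<le> r"
    by (simp add: \<eta>_def power2_eq_square mult_ac)
  then have "\<theta> * (Q * \<beta>)\<^sup>2 / 2 \<le> r * (1 + \<theta>)"
    using \<theta> by (subst (asm) pos_divide_le_eq) auto
  then have "r * ((Q * \<beta>)\<^sup>2 / 2 * \<kappa>) \<le> r * (1 + \<theta>)" by (simp add: \<theta>_def mult_ac)
  then show ?thesis using r by (simp add: \<theta>_def)
qed

text \<open>Compare the lower bound \<open>- \<theta> r / \<beta>\<close> with the cost of resetting at the interval length \<open>1 / sqrt \<theta>\<close>, which balances
  the loss \<open>\<theta> h\<close> from spreading against the energy \<open>1 / h\<close>.\<close>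

lemma order_parameter_lower_bound:
  assumes \<beta>: "\<beta> > 0" and \<kappa>: "\<kappa> > 0" and r: "r > 0" and \<mu>: "\<mu> \<in> torus_prob"
    and sol: "stationary_solution \<beta> \<sigma> M F B \<kappa> \<mu>"
    and polar: "(\<integral>x. cos_torus x \<partial>\<mu>) = r * cos \<phi>" "(\<integral>x. sin_torus x \<partial>\<mu>) = r * sin \<phi>"
  shows "1 - (5 * \<sigma>\<^sup>2 / 2 + (2 + pi\<^sup>2 / 2) * \<beta>) / sqrt (\<kappa> * r) \<le> r"
proof -
  obtain X0 \<alpha> where X0: "X0 \<in> F 0 \<rightarrow>\<^sub>M borel" "distr M borel X0 = \<mu>" and \<alpha>: "progressively_measurable F \<alpha>"
    and opt: "\<And>a. progressively_measurable F a \<Longrightarrow> cost \<beta> \<sigma> M B \<kappa> (\<lambda>_. \<mu>) X0 \<alpha> \<le> cost \<beta> \<sigma> M B \<kappa> (\<lambda>_. \<mu>) X0 a"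
    and law: "\<And>t. t \<ge> 0 \<Longrightarrow> distr M borel (state \<sigma> B X0 \<alpha> t) = \<mu>"
    by (rule stationary_solution_obtain[OF sol]) blast
  define s where "s = sqrt (\<kappa> * r)"
  have s: "s > 0" "\<kappa> * r = s\<^sup>2" using \<kappa> r by (simp_all add: s_def)
  define C where "C = 5 * \<sigma>\<^sup>2 / 2 + (2 + pi\<^sup>2 / 2) * \<beta>"
  have h: "1 / s > 0" using s by simp
  obtain a where a: "progressively_measurable F a"
    "cost \<beta> \<sigma> M B \<kappa> (\<lambda>_. \<mu>) X0 a \<le>
      ereal ((- s\<^sup>2 + 2 * s\<^sup>2 * \<sigma>\<^sup>2 * (1 / s) + \<sigma>\<^sup>2 / (2 * (1 / s))) / \<beta> + 2 * s\<^sup>2 * (1 / s) + pi\<^sup>2 / (2 * (1 / s)))"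
    using cost_of_resetting_control[OF \<beta> _ _ h X0(1) polar, of \<kappa> \<sigma>] \<kappa> r unfolding s(2) by auto
  have "ereal (- (\<kappa> * r) * r / \<beta>) \<le> cost \<beta> \<sigma> M B \<kappa> (\<lambda>_. \<mu>) X0 \<alpha>"
    by (rule cost_ge_of_stationary[OF \<beta> polar \<mu> \<alpha> X0(1) law])
  from order_trans[OF this order_trans[OF opt[OF a(1)] a(2)]]
  have "- s\<^sup>2 * r / \<beta> \<le>
      (- s\<^sup>2 + 2 * s\<^sup>2 * \<sigma>\<^sup>2 * (1 / s) + \<sigma>\<^sup>2 / (2 * (1 / s))) / \<beta> + 2 * s\<^sup>2 * (1 / s) + pi\<^sup>2 / (2 * (1 / s))"
    by (simp only: s(2) ereal_less_eq)
  also have "\<dots> = (- s\<^sup>2 + s * C) / \<beta>"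
    unfolding C_def using s(1) \<beta> by (simp add: field_simps power2_eq_square)
  finally have "- s\<^sup>2 * r \<le> - s\<^sup>2 + s * C"
    using \<beta> by (auto simp only: divide_le_cancel)
  then have "s * (s - C) \<le> s * (s * r)" by (simp add: power2_eq_square right_diff_distrib)
  then have "s - C \<le> s * r" using s(1) by simp
  then have "(s - C) / s \<le> r" using s(1) by (simp add: pos_divide_le_eq mult.commute)
  moreover have "(s - C) / s = 1 - C / s" using s(1) by (simp add: diff_divide_distrib)
  ultimately show ?thesis unfolding C_def s_def by simp
qed

end

theorem theorem4p2:
  fixes \<beta> \<sigma> :: real
    and M :: "'w measure" and F :: "real \<Rightarrow> 'w measure" and B :: "real \<Rightarrow> 'w \<Rightarrow> real"
    and \<kappa> :: "nat \<Rightarrow> real" and \<mu> :: "nat \<Rightarrow> torus measure"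
  assumes "\<beta> > 0" and "\<sigma> > 0"
    and "filtered_prob_space M F" and "usual_conditions M F"
    and "brownian_motion M F B" and "rich_initial M F"
    and "\<And>n. \<kappa> n > 0" and "filterlim \<kappa> at_top sequentially"
    and "\<And>n. \<mu> n \<in> torus_prob"
    and "\<And>n. stationary_solution \<beta> \<sigma> M F B (\<kappa> n) (\<mu> n)"
    and "\<And>n. \<mu> n \<noteq> uniform_torus"
  shows "\<exists>z :: nat \<Rightarrow> torus.
           converges_in_law (\<lambda>n. translate (\<mu> n) (z n)) (return borel 0)"
proof -
  interpret prob_space M using assms(3) by (simp add: filtered_prob_space_def)
  interpret filtered_brownian M F B by unfold_locales (fact assms(3) assms(5))+
  have "\<exists>r \<phi>. 0 \<le> r \<and> r \<le> 1 \<and> (\<integral>x. cos_torus x \<partial>\<mu> n) = r * cos \<phi> \<and> (\<integral>x. sin_torus x \<partial>\<mu> n) = r * sin \<phi>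
      \<and> (\<integral>x. cos_torus x \<partial>translate (\<mu> n) (to_torus (- \<phi>))) = r" for n
    by (rule torus_prob_order_parameter[OF assms(9)[of n]]) blast
  then obtain r \<phi> where r: "\<And>n. 0 \<le> r n" "\<And>n. r n \<le> 1"
    and polar: "\<And>n. (\<integral>x. cos_torus x \<partial>\<mu> n) = r n * cos (\<phi> n)" "\<And>n. (\<integral>x. sin_torus x \<partial>\<mu> n) = r n * sin (\<phi> n)"
    and tr: "\<And>n. (\<integral>x. cos_torus x \<partial>translate (\<mu> n) (to_torus (- \<phi> n))) = r n"
    by metis
  have r0: "r n > 0" for n
  proof (rule ccontr)
    assume "\<not> r n > 0"
    then have "r n = 0" using r(1)[of n] by simp
    then have "\<mu> n = uniform_torus"
      using uniform_if_order_parameter_zero[OF assms(1,2,9,10), of n] polar[of n] by simp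
    then show False using assms(11) by blast
  qed
  define c where "c = (((1 - exp (- 2 * \<sigma>\<^sup>2)) / 2 * exp (- \<sigma>\<^sup>2) * exp (- 3 * \<beta>)) * \<beta>)\<^sup>2 / 2"
  have c: "c > 0" using assms(1,2) by (simp add: c_def)
  have lower: "c * \<kappa> n - 1 \<le> \<kappa> n * r n" for n
    using effective_coupling_lower_bound[OF assms(1,7) r0 assms(9,10) polar refl, of n] by (simp add: c_def)
  have "filterlim (\<lambda>n. c * \<kappa> n - 1) at_top sequentially"
    using filterlim_tendsto_add_at_top[OF tendsto_const[of "-1"] filterlim_tendsto_pos_mult_at_top[OF tendsto_const c assms(8)]]
    by simp
  from filterlim_at_top_mono[OF this] have "filterlim (\<lambda>n. \<kappa> n * r n) at_top sequentially"
    using lower by simp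
  then have "filterlim (\<lambda>n. sqrt (\<kappa> n * r n)) at_top sequentially"
    by (rule filterlim_compose[OF sqrt_at_top])
  then have lim: "(\<lambda>n. (5 * \<sigma>\<^sup>2 / 2 + (2 + pi\<^sup>2 / 2) * \<beta>) / sqrt (\<kappa> n * r n)) \<longlonglongrightarrow> 0"
    by (intro tendsto_divide_0[OF tendsto_const] filterlim_at_top_imp_at_infinity)
  have "r \<longlonglongrightarrow> 1"
  proof (rule real_tendsto_sandwich)
    show "(\<lambda>n. 1 - (5 * \<sigma>\<^sup>2 / 2 + (2 + pi\<^sup>2 / 2) * \<beta>) / sqrt (\<kappa> n * r n)) \<longlonglongrightarrow> 1"
      using tendsto_diff[OF tendsto_const lim, of 1] by simp
    show "\<forall>\<^sub>F n in sequentially. 1 - (5 * \<sigma>\<^sup>2 / 2 + (2 + pi\<^sup>2 / 2) * \<beta>) / sqrt (\<kappa> n * r n) \<le> r n"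
      using order_parameter_lower_bound[OF assms(1,7) r0 assms(9,10) polar] by simp
    show "\<forall>\<^sub>F n in sequentially. r n \<le> 1" using r(2) by simp
  qed simp
  then have "(\<lambda>n. \<integral>x. cos_torus x \<partial>translate (\<mu> n) (to_torus (- \<phi> n))) \<longlonglongrightarrow> 1"
    by (simp add: tr)
  then have "converges_in_law (\<lambda>n. translate (\<mu> n) (to_torus (- \<phi> n))) (return borel 0)"
    by (intro converges_in_law_dirac_if_cos_tendsto_1 translate_torus_prob assms(9))
  then show ?thesis by (rule exI[of _ "\<lambda>n. to_torus (- \<phi> n)"])
qed

end
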